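(* Let $i\ge1$, $0\le k\le i$ and $\ell\ge0$ be integers. Suppose given a set of $M$ (distinct) totally singular subspaces $\bar S$ of $\bar E$, each of dimension $i-k$, such that any two distinct members of the set intersect in a space of dimension at most $\ell$. Then the set of invariant subspaces (in the sense of the context: the simultaneous eigenspaces $V_\chi$) of all the preimages $S\subseteq E$ of these subspaces $\bar S$ is a packing of $2^{i-k}M$ (distinct) planes in $G(2^i,2^k)$ whose minimal distance $d$ satisfies $$d^2\ \ge\ 2^k-2^{2k+\ell-i},$$ i.e. $d(P,P')^2\ge 2^k-2^{2k+\ell-i}$ for any two distinct planes $P,P'$ of the packing.
   Context: **Grassmannian packings.** $G(m,n)$ is the set of $n$-dimensional linear subspaces ("planes") of $\mathbb{R}^m$. The distance between $P,Q\in G(m,n)$ is $d(P,Q)=\sqrt{\sin^2\theta_1+\dots+\sin^2\theta_n}$, where $\theta_1,\dots,\theta_n$ are the principal angles between $P$ and $Q$; equivalently $d^2(P,Q)=n-\operatorname{trace}(\Pi_P\Pi_Q)$, where $\Pi_P,\Pi_Q$ are the orthogonal projection matrices onto $P,Q$. A packing of $N$ planes is a subset $\mathcal P=\{P_1,\dots,P_N\}\subset G(m,n)$ of $N$ planes; its minimal distance is $d(\mathcal P)=\min_{a\ne b}d(P_a,P_b)$. **The group $E$ and the orthogonal space $\bar E$.** Let $i\ge 1$, $U=\mathbb{F}_2^i$ with the usual dot product, and let $V=\mathbb{R}^{2^i}$ with orthonormal basis $(e_u)_{u\in U}$. For $a,b\in U$ define orthogonal transformations of $V$ by $X(a):e_u\mapsto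 e_{u+a}$ and $Y(b):e_u\mapsto(-1)^{b\cdot u}e_u$. Let $E=\{\pm X(a)Y(b):a,b\in U\}$, the group generated by all $X(a)$ and $Y(b)$; it has order $2^{2i+1}$ and center $\{\pm I\}$. Put $\bar E=E/\{\pm I\}$, an elementary abelian $2$-group of order $2^{2i}$, regarded as a $2i$-dimensional vector space over $\mathbb{F}_2$. Define the quadratic form $Q:\bar E\to\mathbb{F}_2$ by $Q(\bar g)=0$ if $g^2=I$ and $Q(\bar g)=1$ if $g^2=-I$, where $g\in E$ is any preimage of $\bar g$; thus $Q(\overline{X(a)Y(b)})=a\cdot b$. A subspace $\bar S\subseteq\bar E$ is totally singular if $Q(\bar g)=0$ for all $\bar g\in\bar S$. **Invariant subspaces.** If $\bar S\subseteq\bar E$ is a totally singular subspace of dimension $r$, its preimage $S\subseteq E$ (which contains $-I$) is an elementary abelian $2$-group of order $2^{r+1}$. The invariant subspaces of $S$ are the simultaneous eigenspaces $V_\chi=\{v\in V: gv=\chi(g)v\ \text{for all } g\in S\}$, where $\chi$ runs over the $2^r$ characters $\chi:S\to\{\pm1\}$ with $\chi(-I)=-1$. They are $2^r$ mutually orthogonal subspaces of $V$, each of dimension $2^{i-r}$. *)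

theory Defs
  imports "HOL-Analysis.Analysis" "HOL-Library.Z2"
begin

section \<open>Packings in Grassmannian spaces\<close>

definition Grassmannian :: "nat \<Rightarrow> 'a::euclidean_space set set" where
  "Grassmannian n = {P. subspace P \<and> dim P = n}"

text \<open>
  Admissible pairs of unit vectors for choosing the \<open>j\<close>-th pair of principal vectors, once
  the pairs with smaller index have been chosen.
\<close>

definition principal_candidates ::
  "'a::euclidean_space set \<Rightarrow> 'a set \<Rightarrow> (nat \<Rightarrow> 'a) \<Rightarrow> (nat \<Rightarrow> 'a) \<Rightarrow> nat \<Rightarrow> ('a \<times> 'a) set" where
  "principal_candidates P Q u v j =
     {(x, y). x \<in> P \<and> y \<in> Q \<and> norm x = 1 \<and> norm y = 1 \<and>
              (\<forall>l<j. x \<bullet> u l = 0 \<and> y \<bullet> v l = 0)}"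

text \<open>
  The usual recursive definition of the principal angles between two planes of equal
  dimension; only the values \<open>\<theta> j\<close> with \<open>j < dim P\<close> matter.
\<close>

definition is_principal_angles ::
  "'a::euclidean_space set \<Rightarrow> 'a set \<Rightarrow> (nat \<Rightarrow> real) \<Rightarrow> bool" where
  "is_principal_angles P Q \<theta> \<longleftrightarrow>
     (\<exists>u v. \<forall>j<dim P.
        (u j, v j) \<in> principal_candidates P Q u v j \<and>
        (\<forall>(x, y) \<in> principal_candidates P Q u v j. x \<bullet> y \<le> u j \<bullet> v j) \<and>
        0 \<le> \<theta> j \<and> \<theta> j \<le> pi / 2 \<and> cos (\<theta> j) = u j \<bullet> v j)"

text \<open>
  The principal vectors need not be unique, but for subspaces of equal dimension principal
  angles exist and the first \<open>dim P\<close> of them are uniquely determined, so the choice below is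
  immaterial.
\<close>

definition principal_angle :: "'a::euclidean_space set \<Rightarrow> 'a set \<Rightarrow> nat \<Rightarrow> real" where
  "principal_angle P Q = (SOME \<theta>. is_principal_angles P Q \<theta>)"

definition plane_dist :: "'a::euclidean_space set \<Rightarrow> 'a set \<Rightarrow> real" where
  "plane_dist P Q = sqrt (\<Sum>j<dim P. (sin (principal_angle P Q j))\<^sup>2)"

definition is_packing :: "nat \<Rightarrow> nat \<Rightarrow> 'a::euclidean_space set set \<Rightarrow> bool" where
  "is_packing N n \<P> \<longleftrightarrow> \<P> \<subseteq> Grassmannian n \<and> finite \<P> \<and> card \<P> = N"

text \<open>Meaningful only for finite packings with at least two planes.\<close>

definition min_dist :: "'a::euclidean_space set set \<Rightarrow> real" where
  "min_dist \<P> = Min {plane_dist P P' | P P'. P \<in> \<P> \<and> P' \<in> \<P> \<and> P \<noteq> P'}"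


section \<open>The group \<open>E\<close>\<close>

instance bit :: finite
proof
  have "(UNIV :: bit set) = {0, 1}"
    by (auto intro: bit.exhaust)
  then show "finite (UNIV :: bit set)"
    by (metis finite.emptyI finite.insertI)
qed

text \<open>
  With \<open>i = CARD('i)\<close>, the type \<open>'i U\<close> is the space of vectors of length \<open>i\<close> over the field with
  two elements, and \<open>'i V\<close> is real Euclidean space of dimension \<open>2 ^ i\<close> with coordinates indexed
  by \<open>'i U\<close>; the basis vector belonging to \<open>u\<close> is \<open>axis u 1\<close>.
\<close>

type_synonym 'i U = "bit ^ 'i"
type_synonym 'i V = "real ^ (bit ^ 'i)"

lemma CARD_bit: "CARD(bit) = 2"
proof -
  have "(UNIV :: bit set) = {0, 1}"
    by (auto intro: bit.exhaust)
  then show ?thesis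
    by (metis card_2_iff zero_neq_one)
qed

lemma DIM_V: "DIM(('i::finite) V) = 2 ^ CARD('i)"
  by (simp add: CARD_bit)

definition dot :: "('i::finite) U \<Rightarrow> 'i U \<Rightarrow> bit" where
  "dot a b = (\<Sum>j\<in>UNIV. a $ j * b $ j)"

definition sign_of :: "bit \<Rightarrow> real" where
  "sign_of c = (if c = 0 then 1 else - 1)"

definition X :: "('i::finite) U \<Rightarrow> 'i V \<Rightarrow> 'i V" where
  "X a v = (\<Sum>u\<in>UNIV. v $ u *\<^sub>R axis (u + a) 1)"

definition Y :: "('i::finite) U \<Rightarrow> 'i V \<Rightarrow> 'i V" where
  "Y b v = (\<Sum>u\<in>UNIV. v $ u *\<^sub>R (sign_of (dot b u) *\<^sub>R axis u 1))"

text \<open>Negation of maps is pointwise, so \<open>- id\<close> is the central element \<open>- I\<close>.\<close>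

definition E :: "(('i::finite) V \<Rightarrow> 'i V) set" where
  "E = {X a \<circ> Y b | a b. True} \<union> {- (X a \<circ> Y b) | a b. True}"

lemma U_add_self [simp]: "(a :: ('i::finite) U) + a = 0"
  by (simp add: vec_eq_iff)

lemma U_add_add [simp]: "(a :: ('i::finite) U) + b + b = a"
  by (simp add: add.assoc)

lemma X_nth: "X a v $ w = v $ (w + a)"
proof -
  have "X a v $ w = (\<Sum>u\<in>UNIV. if u = w + a then v $ u else 0)"
    unfolding X_def sum_component
    by (rule sum.cong) (auto simp: axis_def)
  then show ?thesis by simp
qed

lemma Y_nth: "Y b v $ w = sign_of (dot b w) * v $ w"
proof -
  have "Y b v $ w = (\<Sum>u\<in>UNIV. if u = w then sign_of (dot b u) * v $ u else 0)"
    unfolding Y_def sum_component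
    by (rule sum.cong) (auto simp: axis_def)
  then show ?thesis by simp
qed

lemma axis_nth_eq: "axis u (1::real) $ w = (if w = u then 1 else 0)"
  unfolding axis_def by simp

lemma X_axis: "X a (axis u 1) = axis (u + a) 1"
proof (subst vec_eq_iff, rule allI)
  fix w
  have "w + a = u \<longleftrightarrow> w = u + a"
    using U_add_add[of w a] U_add_add[of u a] by metis
  then show "X a (axis u 1) $ w = axis (u + a) 1 $ w"
    unfolding X_nth axis_nth_eq by simp
qed

lemma Y_axis: "Y b (axis u 1) = sign_of (dot b u) *\<^sub>R axis u 1"
proof (subst vec_eq_iff, rule allI)
  fix w
  show "Y b (axis u 1) $ w = (sign_of (dot b u) *\<^sub>R axis u 1) $ w"
    unfolding Y_nth axis_nth_eq vector_scaleR_component by (cases "w = u") simp_all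
qed

lemma X_0: "X 0 = id"
  by (auto simp: fun_eq_iff vec_eq_iff X_nth)

lemma dot_0_left [simp]: "dot 0 b = 0"
  by (simp add: dot_def)

lemma dot_add_left: "dot (a + a') b = dot a b + dot a' b"
  unfolding dot_def by (simp only: vector_add_component distrib_right sum.distrib)

lemma dot_add_right: "dot a (b + b') = dot a b + dot a b'"
  unfolding dot_def by (simp only: vector_add_component distrib_left sum.distrib)

lemma dot_commute: "dot a b = dot b a"
  unfolding dot_def by (rule sum.cong[OF refl mult.commute])

lemma sign_of_0 [simp]: "sign_of 0 = 1"
  by (simp add: sign_of_def)

lemma sign_of_add: "sign_of (c + d) = sign_of c * sign_of d"
  by (cases c; cases d) (auto simp: sign_of_def)

lemma sign_of_cases: "sign_of c = 1 \<or> sign_of c = - 1"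
  by (simp add: sign_of_def)

lemma sign_of_square [simp]: "sign_of c * sign_of c = 1"
  by (simp add: sign_of_def)

lemma Y_0: "Y 0 = id"
  by (auto simp: fun_eq_iff vec_eq_iff Y_nth)

lemma XY_nth: "(X a \<circ> Y b) v $ w = sign_of (dot b (w + a)) * v $ (w + a)"
  by (simp add: X_nth Y_nth)

lemma E_iff: "g \<in> E \<longleftrightarrow> (\<exists>a b. g = X a \<circ> Y b \<or> g = - (X a \<circ> Y b))"
  by (auto simp: E_def)

lemma XY_comp:
  "(X a \<circ> Y b) \<circ> (X a' \<circ> Y b') =
     (if dot b a' = 0 then X (a + a') \<circ> Y (b + b') else - (X (a + a') \<circ> Y (b + b')))"
proof -
  have "((X a \<circ> Y b) \<circ> (X a' \<circ> Y b')) v $ w =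
      sign_of (dot b a') * (X (a + a') \<circ> Y (b + b')) v $ w" for v w
  proof -
    have "dot b (w + (a + a')) = dot b (w + a) + dot b a'"
      by (simp only: dot_add_right add.assoc)
    then have "sign_of (dot (b + b') (w + (a + a'))) =
        sign_of (dot b (w + a)) * sign_of (dot b a') * sign_of (dot b' (w + (a + a')))"
      by (simp only: dot_add_left sign_of_add)
    moreover have "((X a \<circ> Y b) \<circ> (X a' \<circ> Y b')) v $ w =
        sign_of (dot b (w + a)) * (sign_of (dot b' (w + (a + a'))) * v $ (w + (a + a')))"
      unfolding o_apply X_nth Y_nth add.assoc ..
    moreover have "(X (a + a') \<circ> Y (b + b')) v $ w =
        sign_of (dot (b + b') (w + (a + a'))) * v $ (w + (a + a'))"
      by (rule XY_nth)
    moreover have "p * (r * x) = c * (p * c * r * x)" if "c * c = 1" for p r x c :: real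
    proof -
      have "c * (p * c * r * x) = (c * c) * (p * (r * x))" by (simp only: ac_simps)
      with that show ?thesis by simp
    qed
    ultimately show ?thesis
      by (simp only: sign_of_square)
  qed
  then show ?thesis
    unfolding fun_eq_iff vec_eq_iff by (auto simp: sign_of_def simp del: o_apply)
qed

lemma XY_uminus: "(X a \<circ> Y b) (- v) = - (X a \<circ> Y b) v"
  by (subst vec_eq_iff) (simp only: XY_nth vector_uminus_component mult_minus_right simp_thms)

lemma E_uminus_arg:
  assumes "g \<in> E"
  shows "g (- v) = - g v"
proof -
  from assms obtain a b where "g = X a \<circ> Y b \<or> g = - (X a \<circ> Y b)"
    unfolding E_iff by blast
  then show ?thesis
    using XY_uminus[of a b v] by (elim disjE) (simp_all only: uminus_apply)
qed

lemma neg_id_o [simp]: "- id \<circ> (g :: 'a \<Rightarrow> 'b::ab_group_add) = - g"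
  by (simp add: fun_eq_iff)

lemma neg_o: "- (g :: 'b \<Rightarrow> 'c::ab_group_add) \<circ> h = - (g \<circ> h)"
  by (simp add: fun_eq_iff)

lemma o_neg:
  assumes "g \<in> E"
  shows "g \<circ> - h = - (g \<circ> h)"
  by (rule ext) (simp only: o_apply uminus_apply E_uminus_arg[OF assms])

lemma neg_neg_fun [simp]: "- (- g) = (g :: 'a \<Rightarrow> 'b::ab_group_add)"
  by (simp add: fun_eq_iff)

lemma XY_in_E: "X a \<circ> Y b \<in> E"
  unfolding E_iff by blast

lemma E_neg:
  assumes "g \<in> E"
  shows "- g \<in> E"
proof -
  from assms obtain a b where "g = X a \<circ> Y b \<or> g = - (X a \<circ> Y b)"
    unfolding E_iff by blast
  then have "- g = X a \<circ> Y b \<or> - g = - (X a \<circ> Y b)"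
    using neg_neg_fun[of "X a \<circ> Y b"] by (elim disjE) simp_all
  then show ?thesis
    unfolding E_iff by blast
qed

lemma id_in_E: "id \<in> E"
  using XY_in_E[of 0 0] by (simp add: X_0 Y_0)

lemma XY_comp_cases:
  "(X a \<circ> Y b) \<circ> (X a' \<circ> Y b') = X (a + a') \<circ> Y (b + b') \<or>
   (X a \<circ> Y b) \<circ> (X a' \<circ> Y b') = - (X (a + a') \<circ> Y (b + b'))"
  using XY_comp[of a b a' b'] by presburger

lemma comp_sign_cases:
  assumes "f \<in> E" and "g = f \<or> g = - f" and "h = f' \<or> h = - f'"
  shows "g \<circ> h = f \<circ> f' \<or> g \<circ> h = - (f \<circ> f')"
  using assms(2,3) by (elim disjE) (simp_all only: neg_o o_neg[OF assms(1)] neg_neg_fun simp_thms)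

lemma E_comp_form:
  assumes "g = X a \<circ> Y b \<or> g = - (X a \<circ> Y b)" and "h = X a' \<circ> Y b' \<or> h = - (X a' \<circ> Y b')"
  shows "g \<circ> h = X (a + a') \<circ> Y (b + b') \<or> g \<circ> h = - (X (a + a') \<circ> Y (b + b'))"
  using comp_sign_cases[OF XY_in_E assms] XY_comp_cases[of a b a' b']
  by (elim disjE) (simp_all only: neg_neg_fun simp_thms)

lemma E_comp:
  assumes "g \<in> E" "h \<in> E"
  shows "g \<circ> h \<in> E"
  using assms E_comp_form unfolding E_iff[of g] E_iff[of h] E_iff[of "g \<circ> h"] by blast

lemma E_commute:
  assumes "g \<in> E" "h \<in> E"
  shows "h \<circ> g = g \<circ> h \<or> h \<circ> g = - (g \<circ> h)"
proof -
  from assms obtain a b a' b' where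
    g: "g = X a \<circ> Y b \<or> g = - (X a \<circ> Y b)" and h: "h = X a' \<circ> Y b' \<or> h = - (X a' \<circ> Y b')"
    unfolding E_iff by blast
  have *: "p = q \<or> p = - q" if "p = r \<or> p = - r" "q = r \<or> q = - r"
    for p q r :: "'a V \<Rightarrow> 'a V"
    using that by (elim disjE) (simp_all only: neg_neg_fun simp_thms)
  show ?thesis
    using *[OF E_comp_form[OF h g] E_comp_form[OF g h, unfolded add.commute[of a] add.commute[of b]]] .
qed

lemma E_square:
  assumes "g \<in> E"
  shows "g \<circ> g = id \<or> g \<circ> g = - id"
proof -
  from assms obtain a b where "g = X a \<circ> Y b \<or> g = - (X a \<circ> Y b)"
    unfolding E_iff by blast
  from E_comp_form[OF this this] show ?thesis
    unfolding U_add_self X_0 Y_0 by simp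
qed


section \<open>The quadratic space \<open>E / {\<plusminus> I}\<close>\<close>

definition E_rel :: "(('i::finite) V \<Rightarrow> 'i V) \<Rightarrow> ('i V \<Rightarrow> 'i V) \<Rightarrow> bool" where
  "E_rel g h \<longleftrightarrow> g \<in> E \<and> h \<in> E \<and> (h = g \<or> h = - g)"

lemma part_equivp_E_rel: "part_equivp E_rel"
proof (rule part_equivpI)
  show "\<exists>g :: ('i::finite) V \<Rightarrow> 'i V. E_rel g g"
    using id_in_E by (auto simp: E_rel_def)
  show "symp E_rel" by (auto simp: symp_def E_rel_def)
  show "transp E_rel" by (auto simp: transp_def E_rel_def)
qed

quotient_type (overloaded) 'i Ebar = "('i::finite) V \<Rightarrow> 'i V" / partial: E_rel
  by (rule part_equivp_E_rel)

text \<open>The vector space structure over \<open>\<bbbF>\<^sub>2\<close>, written additively.\<close>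

instantiation Ebar :: (finite) ab_group_add
begin

lift_definition zero_Ebar :: "'a Ebar" is id
  by (simp add: E_rel_def id_in_E)

lift_definition plus_Ebar :: "'a Ebar \<Rightarrow> 'a Ebar \<Rightarrow> 'a Ebar" is "(\<circ>)"
  by (auto simp: E_rel_def E_comp E_neg neg_o o_neg)

definition uminus_Ebar :: "'a Ebar \<Rightarrow> 'a Ebar" where
  "uminus_Ebar x = x"

definition minus_Ebar :: "'a Ebar \<Rightarrow> 'a Ebar \<Rightarrow> 'a Ebar" where
  "minus_Ebar x y = x + y"

instance
proof
  fix x y z :: "'a Ebar"
  show "x + y + z = x + (y + z)"
    by transfer (simp add: E_rel_def E_comp o_assoc)
  show "x + y = y + x"
    by transfer (use E_commute E_comp in \<open>auto simp: E_rel_def\<close>)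
  show "0 + x = x"
    by transfer (simp add: E_rel_def)
  show "- x + x = 0"
    unfolding uminus_Ebar_def
    by transfer (use E_square E_comp id_in_E in \<open>force simp: E_rel_def\<close>)
  show "x - y = x + - y"
    by (simp add: minus_Ebar_def uminus_Ebar_def)
qed

end

lemma Ebar_add_self: "(x :: ('i::finite) Ebar) + x = 0"
  using left_minus[of x] by (simp add: uminus_Ebar_def)

definition Ebar_scale :: "bit \<Rightarrow> ('i::finite) Ebar \<Rightarrow> 'i Ebar" where
  "Ebar_scale c x = (if c = 0 then 0 else x)"

global_interpretation Ebar: vector_space Ebar_scale
proof
  fix a b :: bit and x :: "('i::finite) Ebar"
  show "Ebar_scale (a + b) x = Ebar_scale a x + Ebar_scale b x"
    by (cases a; cases b) (auto simp: Ebar_scale_def Ebar_add_self)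
qed (auto simp: Ebar_scale_def)

lift_definition Q :: "('i::finite) Ebar \<Rightarrow> bit" is "\<lambda>g. if g \<circ> g = id then 0 else 1"
  by (auto simp: E_rel_def neg_o o_neg)

lemma Q_abs:
  assumes "g \<in> E"
  shows "Q (abs_Ebar g) = 0 \<longleftrightarrow> g \<circ> g = id"
    and "Q (abs_Ebar g) = 1 \<longleftrightarrow> g \<circ> g = - id"
proof -
  have rel: "E_rel g g" using assms by (simp add: E_rel_def)
  have "(id :: 'a V \<Rightarrow> 'a V) \<noteq> - id"
  proof
    assume "(id :: 'a V \<Rightarrow> 'a V) = - id"
    then have "id (axis 0 1 :: 'a V) $ 0 = (- id) (axis 0 1 :: 'a V) $ 0" by metis
    then show False by (simp add: axis_def)
  qed
  then show "Q (abs_Ebar g) = 0 \<longleftrightarrow> g \<circ> g = id" "Q (abs_Ebar g) = 1 \<longleftrightarrow> g \<circ> g = - id"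
    using E_square[OF assms] by (auto simp: Q.abs_eq[OF rel])
qed

lemma Q_XY: "Q (abs_Ebar (X a \<circ> Y b)) = dot a b"
proof -
  have sq: "(X a \<circ> Y b) \<circ> (X a \<circ> Y b) = (if dot b a = 0 then id else - id)"
    by (simp only: XY_comp U_add_self X_0 Y_0) simp
  show ?thesis
    using Q_abs[OF XY_in_E[of a b]] unfolding sq
    by (cases "dot a b") (auto simp: dot_commute[of b a])
qed

definition totally_singular :: "('i::finite) Ebar set \<Rightarrow> bool" where
  "totally_singular W \<longleftrightarrow> Ebar.subspace W \<and> (\<forall>x\<in>W. Q x = 0)"


section \<open>Invariant subspaces\<close>

definition preimage :: "('i::finite) Ebar set \<Rightarrow> ('i V \<Rightarrow> 'i V) set" where
  "preimage W = {g \<in> E. abs_Ebar g \<in> W}"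

text \<open>Characters are real-valued functions on all maps; only their values on \<open>S\<close> matter.\<close>

definition is_character :: "(('i::finite) V \<Rightarrow> 'i V) set \<Rightarrow> (('i V \<Rightarrow> 'i V) \<Rightarrow> real) \<Rightarrow> bool" where
  "is_character S \<psi> \<longleftrightarrow>
     (\<forall>g\<in>S. \<psi> g \<in> {1, - 1}) \<and> (\<forall>g\<in>S. \<forall>h\<in>S. \<psi> (g \<circ> h) = \<psi> g * \<psi> h)"

definition eigenspace ::
  "(('i::finite) V \<Rightarrow> 'i V) set \<Rightarrow> (('i V \<Rightarrow> 'i V) \<Rightarrow> real) \<Rightarrow> 'i V set" where
  "eigenspace S \<psi> = {v. \<forall>g\<in>S. g v = \<psi> g *\<^sub>R v}"

definition invariant_subspaces :: "(('i::finite) V \<Rightarrow> 'i V) set \<Rightarrow> 'i V set set" where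
  "invariant_subspaces S = {eigenspace S \<psi> | \<psi>. is_character S \<psi> \<and> \<psi> (- id) = - 1}"

end

theory Submission
  imports Defs
begin

text \<open>
  The orthogonal projection onto the eigenspace of \<open>S\<close> belonging to a character \<open>\<psi>\<close> is the
  average of \<open>\<psi> g *\<^sub>R g\<close> over \<open>g \<in> S\<close>, and every element of \<open>E\<close> other than \<open>\<plusminus> I\<close> has trace
  zero. Expanding the product of the projections for two totally singular subspaces \<open>W\<close>, \<open>W'\<close>,
  only the pairs \<open>(g, \<plusminus> g)\<close> with \<open>g\<close> in both preimages contribute to the trace, which is
  therefore at most \<open>2 ^ i * card (W \<inter> W') / (card W * card W')\<close>. The squared distance is
  the dimension minus this trace, because principal vectors with different indices are orthogonal.
\<close>

section \<open>Principal angles and traces\<close>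

lemma principal_candidates_cong:
  assumes "\<And>l. l < j \<Longrightarrow> u l = u' l" "\<And>l. l < j \<Longrightarrow> v l = v' l"
  shows "principal_candidates P P' u v j = principal_candidates P P' u' v' j"
  using assms unfolding principal_candidates_def by auto

text \<open>The candidate set is a product of two compact sets of unit vectors. Each factor is
  nonempty: \<open>m\<close> vectors span a proper subspace of a space of dimension greater than
  \<open>m\<close>, so a nonzero vector orthogonal to all of them remains and can be normalised. The
  inner product is continuous and attains its maximum.\<close>

lemma principal_candidates_attain_max:
  fixes P P' :: "'a::euclidean_space set"
  assumes P: "subspace P" and P': "subspace P'"
    and mem: "\<And>l. l < m \<Longrightarrow> u l \<in> P \<and> v l \<in> P'"
    and m: "m < dim P" "m < dim P'"
  obtains x y where "(x, y) \<in> principal_candidates P P' u v m"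
    "\<And>x' y'. (x', y') \<in> principal_candidates P P' u v m \<Longrightarrow> x' \<bullet> y' \<le> x \<bullet> y"
proof -
  define C where "C R w = {x \<in> R. norm x = 1 \<and> (\<forall>l<m. x \<bullet> w l = 0)}"
    for R :: "'a set" and w :: "nat \<Rightarrow> 'a"
  have cand: "principal_candidates P P' u v m = C P u \<times> C P' v"
    unfolding principal_candidates_def C_def by auto
  have cpt: "compact (C R w)" if "subspace R" for R w
  proof -
    have "C R w = sphere 0 1 \<inter> (R \<inter> (\<Inter>l\<in>{..<m}. {x. w l \<bullet> x = 0}))"
      unfolding C_def by (auto simp: inner_commute)
    moreover have "closed (\<Inter>l\<in>{..<m}. {x. w l \<bullet> x = 0})"
      by (intro closed_INT ballI closed_hyperplane)
    ultimately show ?thesis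
      using closed_subspace[OF that] by (auto intro!: compact_Int_closed)
  qed
  have ne: "C R w \<noteq> {}" if R: "subspace R" and w: "\<And>l. l < m \<Longrightarrow> w l \<in> R" and "m < dim R" for R w
  proof -
    have sub: "span (w ` {..<m}) \<subseteq> R"
      using R w by (intro span_minimal) auto
    have "dim (w ` {..<m}) \<le> m"
      using dim_le_card'[of "w ` {..<m}"] card_image_le[of "{..<m}" w] by simp
    then have "dim (span (w ` {..<m})) < dim R"
      using that(3) by simp
    then have "span (w ` {..<m}) \<noteq> R"
      by (metis less_irrefl)
    then have "span (w ` {..<m}) \<subset> span R"
      using sub unfolding span_eq_iff[THEN iffD2, OF R] by (rule psubsetI[rotated])
    then obtain x where x: "x \<noteq> 0" "x \<in> span R" "\<And>y. y \<in> span (w ` {..<m}) \<Longrightarrow> orthogonal x y"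
      using orthogonal_to_subspace_exists_gen by blast
    have "x \<in> R"
      using x(2) R by (simp add: span_eq_iff[THEN iffD2])
    moreover have "x \<bullet> w l = 0" if "l < m" for l
      using x(3)[of "w l"] that by (simp add: orthogonal_def span_base)
    ultimately have "(1 / norm x) *\<^sub>R x \<in> C R w"
      using R x(1) unfolding C_def by (simp add: subspace_scale)
    then show ?thesis by blast
  qed
  have "compact (C P u \<times> C P' v)" "C P u \<times> C P' v \<noteq> {}"
    using cpt ne assms by (auto intro!: compact_Times)
  moreover have "continuous_on (C P u \<times> C P' v) (\<lambda>z. fst z \<bullet> snd z)"
    by (intro continuous_intros)
  ultimately obtain z where z: "z \<in> C P u \<times> C P' v"
      "\<And>z'. z' \<in> C P u \<times> C P' v \<Longrightarrow> fst z' \<bullet> snd z' \<le> fst z \<bullet> snd z"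
    using continuous_attains_sup[of "C P u \<times> C P' v" "\<lambda>z. fst z \<bullet> snd z"] by metis
  have "(fst z, snd z) \<in> principal_candidates P P' u v m"
    using z(1) by (simp add: cand)
  moreover have "x' \<bullet> y' \<le> fst z \<bullet> snd z" if "(x', y') \<in> principal_candidates P P' u v m" for x' y'
    using z(2)[of "(x', y')"] that by (simp only: cand fst_conv snd_conv)
  ultimately show thesis by (rule that)
qed

text \<open>\<open>principal_angle\<close> is a \<open>SOME\<close> choice, so existence is what
  gives its values their meaning. The pairs are chosen greedily, by induction on the number
  \<open>m\<close> of pairs.\<close>

lemma principal_angles_exist:
  fixes P P' :: "'a::euclidean_space set"
  assumes P: "subspace P" and P': "subspace P'" and dim: "dim P = dim P'"
  shows "\<exists>\<theta>. is_principal_angles P P' \<theta>"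
proof -
  define good where "good u v j \<longleftrightarrow> (u j, v j) \<in> principal_candidates P P' u v j \<and>
        (\<forall>(x, y) \<in> principal_candidates P P' u v j. x \<bullet> y \<le> u j \<bullet> v j)" for u v :: "nat \<Rightarrow> 'a" and j
  have "\<exists>u v. \<forall>j<m. good u v j" if "m \<le> dim P" for m
    using that
  proof (induction m)
    case (Suc m)
    then obtain u v where uv: "\<And>j. j < m \<Longrightarrow> good u v j" by auto
    then have mem: "\<And>l. l < m \<Longrightarrow> u l \<in> P \<and> v l \<in> P'"
      unfolding good_def principal_candidates_def by blast
    obtain x y where xy: "(x, y) \<in> principal_candidates P P' u v m"
      "\<And>x' y'. (x', y') \<in> principal_candidates P P' u v m \<Longrightarrow> x' \<bullet> y' \<le> x \<bullet> y"
      by (rule principal_candidates_attain_max[of P P' m u v]) (use mem P P' Suc.prems dim in auto)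
    \<comment> \<open>The \<open>j\<close>-th candidate set depends only on entries with index below
      \<open>j\<close>, so writing the new pair at index \<open>m\<close> does not disturb the sets
      for \<open>j \<le> m\<close>.\<close>
    have cong: "principal_candidates P P' (u(m := x)) (v(m := y)) j = principal_candidates P P' u v j"
      if "j \<le> m" for j
      using that by (intro principal_candidates_cong) auto
    have "good (u(m := x)) (v(m := y)) j" if "j < Suc m" for j
    proof (cases "j = m")
      case True
      then show ?thesis
        unfolding good_def using cong[of m] xy by auto
    next
      case False
      then show ?thesis
        using uv[of j] that cong[of j] unfolding good_def by simp
    qed
    then show ?case by blast
  qed simp
  then obtain u v where uv: "\<And>j. j < dim P \<Longrightarrow> good u v j" by blast
  have bounds: "0 \<le> u j \<bullet> v j \<and> u j \<bullet> v j \<le> 1" if "j < dim P" for j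
  proof -
    from uv[OF that] have c: "(u j, v j) \<in> principal_candidates P P' u v j"
      and mx: "\<forall>(x, y) \<in> principal_candidates P P' u v j. x \<bullet> y \<le> u j \<bullet> v j"
      unfolding good_def by auto
    \<comment> \<open>Flipping the sign of \<open>v j\<close> yields another candidate, so
      maximality forces \<open>u j \<bullet> v j\<close> to be nonnegative; this puts the angle in
      the range up to \<open>pi / 2\<close>.\<close>
    from c P' have "(u j, - v j) \<in> principal_candidates P P' u v j"
      unfolding principal_candidates_def by (auto simp: subspace_neg)
    with mx have "u j \<bullet> (- v j) \<le> u j \<bullet> v j" by blast
    moreover have "u j \<bullet> v j \<le> norm (u j) * norm (v j)"
      by (rule norm_cauchy_schwarz)
    ultimately show ?thesis
      using c unfolding principal_candidates_def by auto
  qed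
  have "arccos (u j \<bullet> v j) \<le> pi / 2 \<and> 0 \<le> arccos (u j \<bullet> v j) \<and> cos (arccos (u j \<bullet> v j)) = u j \<bullet> v j"
    if "j < dim P" for j
    using bounds[OF that] by (intro conjI arccos_le_pi2 arccos_lbound cos_arccos) auto
  note arccos = this
  have "is_principal_angles P P' (\<lambda>j. arccos (u j \<bullet> v j))"
    unfolding is_principal_angles_def
    by (rule exI[of _ u], rule exI[of _ v])
      (use uv arccos in \<open>auto simp: good_def\<close>)
  then show ?thesis by blast
qed

text \<open>
  If \<open>x \<bullet> w \<noteq> 0\<close>, rotating \<open>y\<close> towards \<open>w\<close> in the plane spanned by both would increase
  the inner product with \<open>x\<close>.
\<close>

lemma inner_eq_0_if_maximal:
  fixes x y w :: "'a::real_inner"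
  assumes "subspace R" "y \<in> R" "w \<in> R" "norm y = 1" "norm w = 1" "y \<bullet> w = 0"
    and mx: "\<And>z. z \<in> R \<Longrightarrow> norm z = 1 \<Longrightarrow> x \<bullet> z \<le> x \<bullet> y"
  shows "x \<bullet> w = 0"
proof (rule ccontr)
  assume t: "x \<bullet> w \<noteq> 0"
  define s t where "s = x \<bullet> y" and "t = x \<bullet> w"
  define r where "r = sqrt (s\<^sup>2 + t\<^sup>2)"
  have pos: "s\<^sup>2 + t\<^sup>2 > 0" using t by (simp add: t_def add_nonneg_pos)
  have r: "r > 0" "r\<^sup>2 = s\<^sup>2 + t\<^sup>2" using pos by (simp_all add: r_def)
  define z where "z = s *\<^sub>R y + t *\<^sub>R w"
  have "z \<bullet> z = s\<^sup>2 * (y \<bullet> y) + t\<^sup>2 * (w \<bullet> w)"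
    using assms(6) by (simp add: z_def algebra_simps inner_commute[of w y] power2_eq_square)
  then have "norm z = r"
    using assms(4,5) by (simp add: norm_eq_sqrt_inner r_def)
  then have "norm ((1 / r) *\<^sub>R z) = 1" using r by simp
  moreover have "(1 / r) *\<^sub>R z \<in> R"
    unfolding z_def using assms(1-3) by (intro subspace_scale subspace_add)
  ultimately have "x \<bullet> ((1 / r) *\<^sub>R z) \<le> s"
    using mx s_def by blast
  moreover have "x \<bullet> ((1 / r) *\<^sub>R z) = r"
    using r by (simp add: z_def inner_add_right s_def[symmetric] t_def[symmetric]
        power2_eq_square[symmetric] field_simps)
  ultimately have "r \<le> s" by simp
  then have "r\<^sup>2 \<le> s\<^sup>2" using r(1) by (intro power_mono) auto
  then show False using r(2) t by (simp add: t_def)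
qed

text \<open>Within each family, orthogonality is part of the candidacy of the later pair. For the
  mixed products, with \<open>u j\<close> held fixed, \<open>v j\<close> maximises the inner product
  over unit vectors of \<open>P'\<close> orthogonal to the earlier \<open>v m\<close>. As
  \<open>v l\<close> is such a vector and is orthogonal to \<open>v j\<close>,
  \<open>inner_eq_0_if_maximal\<close> applies; the other product is symmetric.\<close>

lemma principal_vectors_orthogonal:
  assumes P: "subspace P" and P': "subspace P'"
    and cand: "\<And>j. j < n \<Longrightarrow> (u j, v j) \<in> principal_candidates P P' u v j"
    and mx: "\<And>j x y. j < n \<Longrightarrow> (x, y) \<in> principal_candidates P P' u v j \<Longrightarrow> x \<bullet> y \<le> u j \<bullet> v j"
    and jl: "j < n" "l < n" "j < l"
  shows "u j \<bullet> u l = 0" "v j \<bullet> v l = 0" "u j \<bullet> v l = 0" "u l \<bullet> v j = 0"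
proof -
  note cj = cand[OF jl(1)] and cl = cand[OF jl(2)]
  show ul: "u j \<bullet> u l = 0" and vl: "v j \<bullet> v l = 0"
    using cl jl unfolding principal_candidates_def by (auto simp: inner_commute)
  define R where "R = P' \<inter> {y. \<forall>m<j. y \<bullet> v m = 0}"
  define R' where "R' = P \<inter> {x. \<forall>m<j. x \<bullet> u m = 0}"
  have R: "subspace R" "subspace R'"
    using P P' unfolding R_def R'_def by (auto simp: subspace_def inner_add_left)
  show "u j \<bullet> v l = 0"
  proof (rule inner_eq_0_if_maximal[OF R(1) _ _ _ _ vl])
    show "u j \<bullet> z \<le> u j \<bullet> v j" if "z \<in> R" "norm z = 1" for z
      using mx[OF jl(1), of "u j" z] that cj unfolding R_def principal_candidates_def by auto
  qed (use cj cl jl in \<open>auto simp: R_def principal_candidates_def\<close>)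
  have "v j \<bullet> u l = 0"
  proof (rule inner_eq_0_if_maximal[OF R(2) _ _ _ _ ul])
    show "v j \<bullet> z \<le> v j \<bullet> u j" if "z \<in> R'" "norm z = 1" for z
      using mx[OF jl(1), of z "v j"] that cj unfolding R'_def principal_candidates_def
      by (auto simp: inner_commute)
  qed (use cj cl jl in \<open>auto simp: R'_def principal_candidates_def\<close>)
  then show "u l \<bullet> v j = 0" by (simp add: inner_commute)
qed

section \<open>Traces, orthogonal projections and the trace formula for the distance\<close>

definition tr :: "('a::euclidean_space \<Rightarrow> 'a) \<Rightarrow> real" where
  "tr f = (\<Sum>b\<in>Basis. f b \<bullet> b)"

text \<open>The second conjunct says that \<open>v - p v\<close> is orthogonal to \<open>P\<close>;
  for a subspace this characterises the orthogonal projection without choosing a basis.\<close>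

definition is_proj :: "'a::real_inner set \<Rightarrow> ('a \<Rightarrow> 'a) \<Rightarrow> bool" where
  "is_proj P p \<longleftrightarrow> (\<forall>v. p v \<in> P) \<and> (\<forall>x\<in>P. \<forall>v. x \<bullet> p v = x \<bullet> v)"

text \<open>By counting dimensions the family spans \<open>P\<close>. The difference
  \<open>y\<close> of the two sides lies in that span and is orthogonal to each \<open>u j\<close>,
  hence to itself.\<close>

lemma orthonormal_expand:
  fixes u :: "nat \<Rightarrow> 'a::euclidean_space"
  assumes P: "subspace P" and mem: "\<And>j. j < dim P \<Longrightarrow> u j \<in> P"
    and on: "\<And>j l. j < dim P \<Longrightarrow> l < dim P \<Longrightarrow> u j \<bullet> u l = (if j = l then 1 else 0)"
    and x: "x \<in> P"
  shows "x = (\<Sum>j<dim P. (u j \<bullet> x) *\<^sub>R u j)"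
proof -
  let ?B = "u ` {..<dim P}"
  have inj: "inj_on u {..<dim P}"
    by (rule inj_onI) (metis lessThan_iff on zero_neq_one)
  have "pairwise orthogonal ?B" "0 \<notin> ?B"
    using on by (auto simp: pairwise_def orthogonal_def) (metis inner_zero_left on zero_neq_one)
  then have "independent ?B"
    by (rule pairwise_orthogonal_independent)
  then have "P \<subseteq> span ?B"
    using mem card_image[OF inj] by (intro card_ge_dim_independent) auto
  define y where "y = x - (\<Sum>j<dim P. (u j \<bullet> x) *\<^sub>R u j)"
  have "u l \<bullet> y = 0" if "l < dim P" for l
  proof -
    have "u l \<bullet> (\<Sum>j<dim P. (u j \<bullet> x) *\<^sub>R u j) = (\<Sum>j<dim P. if j = l then u l \<bullet> x else 0)"
      unfolding inner_sum_right by (rule sum.cong) (auto simp: on that)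
    then show ?thesis
      using that by (simp add: y_def inner_diff_right)
  qed
  then have "orthogonal y b" if "b \<in> ?B" for b
    using that by (auto simp: orthogonal_def inner_commute)
  moreover have "y \<in> span ?B"
    using \<open>P \<subseteq> span ?B\<close> x P mem unfolding y_def
    by (intro span_diff span_sum span_scale) (auto intro: span_base)
  ultimately have "orthogonal y y"
    using orthogonal_to_span by blast
  then show ?thesis by (simp add: y_def orthogonal_self)
qed

text \<open>Replaces the standard basis by an orthonormal family of \<open>P\<close>: after
  expanding \<open>p b\<close> in the family and swapping the sums, the sum over \<open>b\<close>
  recombines to an inner product.\<close>

lemma tr_o_proj:
  fixes u :: "nat \<Rightarrow> 'a::euclidean_space"
  assumes P: "subspace P" and mem: "\<And>j. j < dim P \<Longrightarrow> u j \<in> P"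
    and on: "\<And>j l. j < dim P \<Longrightarrow> l < dim P \<Longrightarrow> u j \<bullet> u l = (if j = l then 1 else 0)"
    and p: "is_proj P p" and f: "linear f"
  shows "tr (f \<circ> p) = (\<Sum>j<dim P. f (u j) \<bullet> u j)"
proof -
  have "p b = (\<Sum>j<dim P. (u j \<bullet> b) *\<^sub>R u j)" for b
    using orthonormal_expand[OF P mem on, of "p b"] p mem unfolding is_proj_def by simp
  then have "f (p b) \<bullet> b = (\<Sum>j<dim P. (u j \<bullet> b) * (f (u j) \<bullet> b))" for b
    by (simp add: linear_sum[OF f] linear_cmul[OF f] inner_sum_left)
  then have "tr (f \<circ> p) = (\<Sum>j<dim P. \<Sum>b\<in>Basis. (f (u j) \<bullet> b) * (u j \<bullet> b))"
    unfolding tr_def by (simp add: sum.swap[of _ _ Basis] mult.commute)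
  then show ?thesis
    by (simp add: euclidean_inner[symmetric])
qed

lemma orthonormal_family_exists:
  fixes P :: "'a::euclidean_space set"
  assumes "subspace P"
  obtains u :: "nat \<Rightarrow> 'a" where "\<And>j. j < dim P \<Longrightarrow> u j \<in> P"
    "\<And>j l. j < dim P \<Longrightarrow> l < dim P \<Longrightarrow> u j \<bullet> u l = (if j = l then 1 else 0)"
proof -
  obtain B where B: "B \<subseteq> P" "pairwise orthogonal B" "\<And>x. x \<in> B \<Longrightarrow> norm x = 1"
      "independent B" "card B = dim P"
    using orthonormal_basis_subspace[OF assms] by metis
  have "finite B" using B(4) by (rule independent_imp_finite)
  then obtain u where "bij_betw u {0..<card B} B"
    using ex_bij_betw_nat_finite by blast
  then have u: "bij_betw u {..<dim P} B"
    using B(5) by (simp add: lessThan_atLeast0)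
  show thesis
  proof
    show "u j \<in> P" if "j < dim P" for j
      using u that B(1) by (auto simp: bij_betw_def)
    fix j l assume jl: "j < dim P" "l < dim P"
    then have m: "u j \<in> B" "u l \<in> B" using u by (auto simp: bij_betw_def)
    have "j \<noteq> l \<Longrightarrow> u j \<noteq> u l" using u jl by (auto simp: bij_betw_def inj_on_def)
    then show "u j \<bullet> u l = (if j = l then 1 else 0)"
      using m B(2) B(3)[of "u l"] by (auto simp: pairwise_def orthogonal_def norm_eq_1)
  qed
qed

lemma tr_proj:
  fixes P :: "'a::euclidean_space set"
  assumes P: "subspace P" and p: "is_proj P p"
  shows "tr p = dim P"
proof -
  obtain u :: "nat \<Rightarrow> 'a" where u: "\<And>j. j < dim P \<Longrightarrow> u j \<in> P"
    "\<And>j l. j < dim P \<Longrightarrow> l < dim P \<Longrightarrow> u j \<bullet> u l = (if j = l then 1 else 0)"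
    using orthonormal_family_exists[OF P] by blast
  show ?thesis
    using tr_o_proj[OF P u p linear_id] u(2) by simp
qed

text \<open>The \<open>u j\<close> and the \<open>v j\<close> form orthonormal families of
  \<open>P\<close> and \<open>P'\<close>, and mixed products with different indices vanish. Hence
  \<open>p'\<close> sends \<open>u j\<close> to \<open>(u j \<bullet> v j) *\<^sub>R v j\<close>, so
  the \<open>j\<close>-th term of the trace is the squared cosine of the \<open>j\<close>-th
  angle.\<close>

lemma plane_dist_sq:
  fixes P P' :: "'a::euclidean_space set"
  assumes P: "subspace P" and P': "subspace P'" and dim: "dim P = dim P'"
    and p: "is_proj P p" and p': "is_proj P' p'" and lin: "linear p'"
  shows "(plane_dist P P')\<^sup>2 = dim P - tr (p' \<circ> p)"
proof -
  let ?\<theta> = "principal_angle P P'"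
  have "is_principal_angles P P' ?\<theta>"
    unfolding principal_angle_def using principal_angles_exist[OF P P' dim] by (rule someI_ex)
  then obtain u v where uv: "\<And>j. j < dim P \<Longrightarrow> (u j, v j) \<in> principal_candidates P P' u v j"
    "\<And>j x y. j < dim P \<Longrightarrow> (x, y) \<in> principal_candidates P P' u v j \<Longrightarrow> x \<bullet> y \<le> u j \<bullet> v j"
    and cos: "\<And>j. j < dim P \<Longrightarrow> cos (?\<theta> j) = u j \<bullet> v j"
    unfolding is_principal_angles_def by fast
  have orth: "u j \<bullet> u l = 0 \<and> v j \<bullet> v l = 0 \<and> u j \<bullet> v l = 0 \<and> u l \<bullet> v j = 0"
    if "j < dim P" "l < dim P" "j < l" for j l
    by (intro conjI; rule principal_vectors_orthogonal[where n = "dim P", OF P P' _ _ that])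
      (erule uv(1), erule uv(2), assumption)+
  have mem: "u j \<in> P" "v j \<in> P'" "u j \<bullet> u j = 1" "v j \<bullet> v j = 1" if "j < dim P" for j
    using uv(1)[OF that] unfolding principal_candidates_def by (auto simp: norm_eq_1)
  \<comment> \<open>\<open>orth\<close> speaks of \<open>j < l\<close> only; using it in both orders
    covers all pairs of different indices.\<close>
  have u: "u j \<bullet> u l = (if j = l then 1 else 0)" and v: "v j \<bullet> v l = (if j = l then 1 else 0)"
    and uv0: "j \<noteq> l \<Longrightarrow> u j \<bullet> v l = 0"
    if "j < dim P" "l < dim P" for j l
  proof -
    have "j = l \<or> (u j \<bullet> u l = 0 \<and> v j \<bullet> v l = 0 \<and> u j \<bullet> v l = 0)"
      using orth[OF that] orth[OF that(2,1)] inner_commute[of "u l" "u j"] inner_commute[of "v l" "v j"]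
      by (cases j l rule: linorder_cases) auto
    then show "u j \<bullet> u l = (if j = l then 1 else 0)" "v j \<bullet> v l = (if j = l then 1 else 0)"
      "j \<noteq> l \<Longrightarrow> u j \<bullet> v l = 0"
      using mem(3,4)[OF that(1)] by auto
  qed
  have inner: "p' (u j) \<bullet> u j = (u j \<bullet> v j)\<^sup>2" if j: "j < dim P" for j
  proof -
    have "p' (u j) = (\<Sum>l<dim P'. (v l \<bullet> p' (u j)) *\<^sub>R v l)"
      using mem v p' dim unfolding is_proj_def by (intro orthonormal_expand[OF P']) auto
    also have "\<dots> = (\<Sum>l<dim P. (v l \<bullet> u j) *\<^sub>R v l)"
      using mem p' dim unfolding is_proj_def by simp
    also have "\<dots> = (\<Sum>l<dim P. if l = j then (u j \<bullet> v j) *\<^sub>R v j else 0)"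
      by (rule sum.cong) (use uv0[OF j] in \<open>auto simp: inner_commute[of _ "u j"]\<close>)
    also have "\<dots> = (u j \<bullet> v j) *\<^sub>R v j" using j by simp
    finally show ?thesis
      by (simp add: power2_eq_square inner_commute)
  qed
  have "(plane_dist P P')\<^sup>2 = (\<Sum>j<dim P. (sin (?\<theta> j))\<^sup>2)"
    unfolding plane_dist_def by (simp add: sum_nonneg)
  also have "\<dots> = (\<Sum>j<dim P. 1 - p' (u j) \<bullet> u j)"
    by (rule sum.cong) (auto simp: sin_squared_eq cos inner)
  also have "\<dots> = dim P - tr (p' \<circ> p)"
    using tr_o_proj[OF P mem(1) u p lin] by (simp add: sum_subtractf)
  finally show ?thesis .
qed

section \<open>Traces on the group \<open>E\<close>\<close>

text \<open>The scalar \<open>c\<close> absorbs the central sign, so that later coordinate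
  computations treat \<open>X a \<circ> Y b\<close> and its negative together.\<close>

lemma E_nth_cases:
  assumes "g \<in> E"
  obtains a b c where "c \<in> {1, -1}"
    "\<And>v w. g v $ w = c * (sign_of (dot b (w + a)) * v $ (w + a))"
proof -
  from assms obtain a b where "g = X a \<circ> Y b \<or> g = - (X a \<circ> Y b)"
    unfolding E_iff by blast
  then show thesis
  proof
    assume "g = X a \<circ> Y b"
    then show thesis using that[of 1 b a] XY_nth[of a b] by simp
  next
    assume "g = - (X a \<circ> Y b)"
    then show thesis
      using that[of "-1" b a] XY_nth[of a b] by simp
  qed
qed

lemma linear_E:
  assumes "g \<in> E"
  shows "linear g"
proof -
  obtain a b c where "\<And>v w. g v $ w = c * (sign_of (dot b (w + a)) * v $ (w + a))"
    using assms by (rule E_nth_cases) blast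
  then show ?thesis
    by (intro linearI) (simp_all add: vec_eq_iff algebra_simps)
qed

lemma bij_add_U: "bij (\<lambda>w :: ('i::finite) U. w + a)"
  by (rule bij_betw_byWitness[of _ "\<lambda>w. w + a"]) auto

text \<open>Elements of \<open>E\<close> permute the coordinates up to signs, and the signs cancel
  in the inner product.\<close>

lemma inner_E:
  assumes "g \<in> E"
  shows "g v \<bullet> g w = v \<bullet> w"
proof -
  obtain a b c where c: "c \<in> {1, -1}"
    and g: "\<And>v w. g v $ w = c * (sign_of (dot b (w + a)) * v $ (w + a))"
    using assms by (rule E_nth_cases) blast
  have *: "(c * (s * x)) * (c * (s * y)) = x * y" if "s = 1 \<or> s = -1" for s x y :: real
    using that c by auto
  have "g v \<bullet> g w = (\<Sum>u\<in>UNIV. v $ (u + a) * w $ (u + a))"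
    unfolding inner_vec_def g inner_real_def by (simp only: *[OF sign_of_cases])
  also have "\<dots> = (\<Sum>u\<in>UNIV. v $ u * w $ u)"
    by (rule sum.reindex_bij_betw[OF bij_add_U, of "\<lambda>u. v $ u * w $ u"])
  finally show ?thesis by (simp add: inner_vec_def)
qed

lemma E_neq_uminus:
  assumes "g \<in> E"
  shows "g \<noteq> - g"
proof
  assume "g = - g"
  then have "g (axis 0 1) = - g (axis 0 1)" by (metis uminus_apply)
  then have "g (axis 0 1) $ w = - (g (axis 0 1) $ w)" for w
    by (metis vector_uminus_component)
  then have "g (axis 0 1) = 0"
    by (simp add: vec_eq_iff)
  with inner_E[OF assms, of "axis 0 1" "axis 0 1"] show False
    by (simp add: inner_axis_axis)
qed

text \<open>Translation by the unit vector at a coordinate where \<open>b\<close> is 1 permutes the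
  summands and flips every sign, so the sum equals its own negative.\<close>

lemma sum_sign_of_dot:
  fixes b :: "('i::finite) U"
  assumes "b \<noteq> 0"
  shows "(\<Sum>u\<in>UNIV. sign_of (dot b u)) = 0"
proof -
  obtain j where j: "b $ j = 1"
    using assms by (auto simp: vec_eq_iff)
  have "dot b (axis j 1) = (\<Sum>m\<in>UNIV. if m = j then b $ m else 0)"
    unfolding dot_def by (rule sum.cong) (auto simp: axis_def)
  then have "dot b (axis j 1) = 1" using j by simp
  then have "sign_of (dot b (u + axis j 1)) = - sign_of (dot b u)" for u
    unfolding dot_add_right sign_of_add by (simp add: sign_of_def)
  then have "(\<Sum>u\<in>UNIV. sign_of (dot b (u + axis j 1))) = - (\<Sum>u\<in>UNIV. sign_of (dot b u))"
    by (simp only: sum_negf)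
  moreover have "(\<Sum>u\<in>UNIV. sign_of (dot b (u + axis j 1))) = (\<Sum>u\<in>UNIV. sign_of (dot b u))"
    by (rule sum.reindex_bij_betw[OF bij_add_U, of "\<lambda>u. sign_of (dot b u)"])
  ultimately show ?thesis by simp
qed

lemma tr_vec: "tr f = (\<Sum>u\<in>UNIV. f (axis u 1) $ u)"
  for f :: "real ^ 'n \<Rightarrow> real ^ 'n"
proof -
  have "(Basis :: (real ^ 'n) set) = range (\<lambda>u. axis u 1)"
    by (auto simp: Basis_vec_def)
  moreover have "inj (\<lambda>u::'n. axis u (1::real))"
    by (auto simp: inj_def axis_eq_axis)
  ultimately have "tr f = (\<Sum>u\<in>UNIV. f (axis u 1) \<bullet> axis u 1)"
    unfolding tr_def by (metis (no_types, lifting) comp_apply sum.cong sum.reindex)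
  then show ?thesis by (simp add: inner_axis)
qed

lemma tr_id: "tr (id :: ('i::finite) V \<Rightarrow> 'i V) = 2 ^ CARD('i)"
  by (simp add: tr_vec CARD_bit)

lemma tr_uminus: "tr (- f) = - tr f"
  by (simp add: tr_def sum_negf)

text \<open>If \<open>a\<close> is nonzero, every basis vector is moved and the diagonal is zero. If
  \<open>a = 0\<close>, the diagonal consists of the signs belonging to a nonzero \<open>b\<close>,
  which cancel.\<close>

lemma tr_E:
  assumes "g \<in> E" "g \<noteq> id" "g \<noteq> - id"
  shows "tr g = 0"
proof -
  obtain a b c where c: "c \<in> {1, -1}"
    and g: "\<And>v w. g v $ w = c * (sign_of (dot b (w + a)) * v $ (w + a))"
    using assms(1) by (rule E_nth_cases) blast
  show ?thesis
  proof (cases "a = 0")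
    case True
    have "b \<noteq> 0"
    proof
      assume "b = 0"
      then have "g v $ w = c * v $ w" for v w using g True by simp
      then have "g = id \<or> g = - id"
        using c by (auto simp: fun_eq_iff vec_eq_iff)
      then show False using assms by simp
    qed
    then show ?thesis
      by (simp add: tr_vec g True axis_nth_eq sum_distrib_left[symmetric] sum_sign_of_dot)
  next
    case False
    then show ?thesis by (simp add: tr_vec g axis_nth_eq)
  qed
qed

section \<open>Totally singular subspaces and their preimages\<close>

lemma abs_Ebar_id: "abs_Ebar id = 0"
  by (simp add: zero_Ebar.abs_eq)

lemma abs_Ebar_comp:
  assumes "g \<in> E" "h \<in> E"
  shows "abs_Ebar (g \<circ> h) = abs_Ebar g + abs_Ebar h"
  using assms by (subst plus_Ebar.abs_eq) (auto simp: E_rel_def)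

lemma abs_Ebar_eq_iff:
  assumes "g \<in> E" "h \<in> E"
  shows "abs_Ebar g = abs_Ebar h \<longleftrightarrow> h = g \<or> h = - g"
proof -
  have "E_rel g h \<longleftrightarrow> abs_Ebar g = abs_Ebar h"
    using Quotient_rel[OF Quotient_Ebar, of g h] assms by (auto simp: E_rel_def)
  then show ?thesis using assms by (simp add: E_rel_def)
qed

lemma abs_Ebar_surj:
  obtains g where "g \<in> E" "x = abs_Ebar g"
  using Quotient_abs_rep[OF Quotient_Ebar, of x] Quotient_rep_reflp[OF Quotient_Ebar, of x]
  by (metis E_rel_def)

section \<open>Cardinalities of preimages and of subspaces of the quotient\<close>

lemma finite_E: "finite (E :: (('i::finite) V \<Rightarrow> 'i V) set)"
proof -
  let ?F = "(\<lambda>(a, b). X a \<circ> Y b) ` (UNIV :: ('i U \<times> 'i U) set)"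
  have "E \<subseteq> ?F \<union> uminus ` ?F"
    unfolding E_def by force
  moreover have "finite (?F \<union> uminus ` ?F)" by simp
  ultimately show ?thesis by (rule finite_subset)
qed

lemma finite_Ebar: "finite (W :: ('i::finite) Ebar set)"
proof -
  have "W \<subseteq> abs_Ebar ` E" by (metis abs_Ebar_surj image_eqI subsetI)
  then show ?thesis using finite_E finite_surj by blast
qed

lemma finite_preimage: "finite (preimage W)"
  using finite_E by (rule finite_subset[rotated]) (auto simp: preimage_def)

lemma preimage_uminus:
  assumes "g \<in> preimage W"
  shows "- g \<in> preimage W"
proof -
  have "abs_Ebar (- g) = abs_Ebar g"
    using assms E_neg by (subst abs_Ebar_eq_iff) (auto simp: preimage_def)
  moreover have "- g \<in> E" using assms by (intro E_neg) (simp add: preimage_def)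
  ultimately show ?thesis using assms by (simp add: preimage_def)
qed

text \<open>With a section \<open>r\<close> of the quotient map, the fibre over \<open>x\<close> is
  \<open>{r x, - r x}\<close>. Fibres over different points are disjoint, and each has two elements
  because \<open>g \<noteq> - g\<close> in \<open>E\<close>.\<close>

lemma card_preimage: "card (preimage W) = 2 * card W"
proof -
  obtain r :: "'a Ebar \<Rightarrow> 'a V \<Rightarrow> 'a V" where r: "\<And>x. r x \<in> E" "\<And>x. x = abs_Ebar (r x)"
    using abs_Ebar_surj by metis
  have eq: "preimage W = (\<Union>x\<in>W. {r x, - r x})"
  proof (intro subset_antisym subsetI)
    fix g assume g: "g \<in> preimage W"
    then have "g = r (abs_Ebar g) \<or> g = - r (abs_Ebar g)"
      using abs_Ebar_eq_iff[of "r (abs_Ebar g)" g] r by (auto simp: preimage_def)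
    then show "g \<in> (\<Union>x\<in>W. {r x, - r x})" using g by (auto simp: preimage_def)
  next
    fix g assume "g \<in> (\<Union>x\<in>W. {r x, - r x})"
    then obtain x where x: "x \<in> W" "g = r x \<or> g = - r x" by blast
    have "r x \<in> preimage W" using r x(1) by (simp add: preimage_def flip: r(2))
    then show "g \<in> preimage W" using x(2) preimage_uminus by blast
  qed
  have "{r x, - r x} \<inter> {r y, - r y} = {}" if "x \<noteq> y" for x y
  proof (rule ccontr)
    assume "{r x, - r x} \<inter> {r y, - r y} \<noteq> {}"
    then have "r y = r x \<or> r y = - r x"
      by (auto dest: arg_cong[of _ _ uminus])
    then have "abs_Ebar (r x) = abs_Ebar (r y)"
      using abs_Ebar_eq_iff[OF r(1) r(1)] by blast
    with that show False by (simp flip: r(2))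
  qed
  then have "card (preimage W) = (\<Sum>x\<in>W. card {r x, - r x})"
    unfolding eq by (intro card_UN_disjoint) (auto simp: finite_Ebar)
  also have "\<dots> = 2 * card W"
    using E_neq_uminus[OF r(1)] by simp
  finally show ?thesis .
qed

text \<open>There are only two scalars, so adjoining an independent \<open>b\<close> adds exactly
  the translate of the old span by \<open>b\<close>. This translate is disjoint from the old span,
  and the cardinality doubles.\<close>

lemma card_Ebar_span:
  fixes B :: "('i::finite) Ebar set"
  assumes "Ebar.independent B"
  shows "card (Ebar.span B) = 2 ^ card B"
  using finite_Ebar[of B] assms
proof (induction B rule: finite_induct)
  case (insert b B)
  then have ind: "Ebar.independent B" "b \<notin> Ebar.span B"
    using Ebar.independent_insert[of b B] by auto
  have diff: "x - b = x + b" for x :: "'i Ebar" by (simp add: minus_Ebar_def)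
  have eq: "Ebar.span (insert b B) = Ebar.span B \<union> (\<lambda>x. x + b) ` Ebar.span B"
  proof -
    have "(\<exists>k. x - Ebar_scale k b \<in> Ebar.span B) \<longleftrightarrow> x \<in> Ebar.span B \<or> x + b \<in> Ebar.span B" for x
    proof -
      have "(\<exists>k. x - Ebar_scale k b \<in> Ebar.span B) \<longleftrightarrow>
          x - Ebar_scale 0 b \<in> Ebar.span B \<or> x - Ebar_scale 1 b \<in> Ebar.span B"
        by (metis bit.exhaust)
      then show ?thesis by (simp only: Ebar_scale_def diff simp_thms if_True if_False zero_neq_one
            one_neq_zero diff_0_right)
    qed
    moreover have "x + b \<in> Ebar.span B \<longleftrightarrow> x \<in> (\<lambda>x. x + b) ` Ebar.span B" for x
    proof
      assume "x + b \<in> Ebar.span B"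
      then show "x \<in> (\<lambda>x. x + b) ` Ebar.span B"
        by (rule rev_image_eqI) (simp add: add.assoc Ebar_add_self)
    qed (auto simp: add.assoc Ebar_add_self)
    ultimately show ?thesis
      by (intro set_eqI) (simp only: Ebar.span_insert mem_Collect_eq Un_iff)
  qed
  have "Ebar.span B \<inter> (\<lambda>x. x + b) ` Ebar.span B = {}"
  proof (rule ccontr)
    assume "\<not> ?thesis"
    then obtain x where x: "x \<in> Ebar.span B" "x + b \<in> Ebar.span B" by blast
    then have "(x + b) - x \<in> Ebar.span B" by (intro Ebar.span_diff)
    with ind show False by simp
  qed
  then have "card (Ebar.span (insert b B)) = card (Ebar.span B) + card ((\<lambda>x. x + b) ` Ebar.span B)"
    unfolding eq by (intro card_Un_disjoint finite_Ebar)
  also have "card ((\<lambda>x. x + b) ` Ebar.span B) = card (Ebar.span B)"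
    by (intro card_image) auto
  finally show ?case using insert ind by simp
qed simp

lemma card_Ebar_subspace:
  fixes W :: "('i::finite) Ebar set"
  assumes "Ebar.subspace W"
  shows "card W = 2 ^ Ebar.dim W"
proof -
  obtain B where B: "B \<subseteq> W" "Ebar.independent B" "W \<subseteq> Ebar.span B" "card B = Ebar.dim W"
    using Ebar.basis_exists by blast
  then have "Ebar.span B = W"
    using assms by (intro subset_antisym Ebar.span_minimal)
  then show ?thesis using card_Ebar_span[OF B(2)] B(4) by simp
qed

section \<open>Preimages of totally singular subspaces as groups of commuting symmetric
  involutions\<close>

context
  fixes W :: "('i::finite) Ebar set"
  assumes W: "totally_singular W"
begin

lemma preimage_E: "g \<in> preimage W \<Longrightarrow> g \<in> E"
  by (simp add: preimage_def)

lemma id_in_preimage: "id \<in> preimage W"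
  using W Ebar.subspace_0[of W]
  by (simp add: preimage_def abs_Ebar_id id_in_E totally_singular_def)

lemma preimage_comp: "g \<in> preimage W \<Longrightarrow> h \<in> preimage W \<Longrightarrow> g \<circ> h \<in> preimage W"
  using W by (auto simp: preimage_def abs_Ebar_comp E_comp totally_singular_def Ebar.subspace_def)

lemma preimage_square: "g \<in> preimage W \<Longrightarrow> g \<circ> g = id"
  using W Q_abs(1)[of g] by (auto simp: preimage_def totally_singular_def)

lemma preimage_apply_twice: "g \<in> preimage W \<Longrightarrow> g (g v) = v"
  using preimage_square[of g] by (metis comp_apply id_apply)

lemma preimage_commute:
  assumes "g \<in> preimage W" "h \<in> preimage W"
  shows "g (h v) = h (g v)"
proof -
  \<comment> \<open>This is the involution property of \<open>g \<circ> h\<close> at the vector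
    \<open>h (g v)\<close>; cancelling the inner \<open>h\<close> and then \<open>g\<close> leaves
    the commutation law.\<close>
  have "g (h (g (h (h (g v))))) = h (g v)"
    using preimage_apply_twice[OF preimage_comp[OF assms]] by simp
  then show ?thesis
    by (simp add: preimage_apply_twice assms)
qed

text \<open>An isometry that is its own inverse is self-adjoint.\<close>

lemma preimage_symmetric: "g \<in> preimage W \<Longrightarrow> g v \<bullet> w = v \<bullet> g w"
  using inner_E[OF preimage_E, of g v "g w"] by (simp add: preimage_apply_twice)

end

section \<open>Projections onto invariant subspaces\<close>

text \<open>For totally singular \<open>W\<close> the preimage contains \<open>- id\<close>, which
  acts as -1; a character with value 1 there would have the zero space as eigenspace.\<close>

definition odd_char :: "('i::finite) Ebar set \<Rightarrow> (('i V \<Rightarrow> 'i V) \<Rightarrow> real) \<Rightarrow> bool" where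
  "odd_char W \<psi> \<longleftrightarrow> is_character (preimage W) \<psi> \<and> \<psi> (- id) = - 1"

definition char_proj ::
  "('i::finite) Ebar set \<Rightarrow> (('i V \<Rightarrow> 'i V) \<Rightarrow> real) \<Rightarrow> 'i V \<Rightarrow> 'i V" where
  "char_proj W \<psi> v = (1 / card (preimage W)) *\<^sub>R (\<Sum>g\<in>preimage W. \<psi> g *\<^sub>R g v)"

lemma subspace_eigenspace:
  assumes "\<And>g. g \<in> S \<Longrightarrow> linear g"
  shows "subspace (eigenspace S \<psi>)"
  unfolding eigenspace_def
  by (auto simp: subspace_def linear_0 linear_add linear_cmul assms algebra_simps)

lemma subspace_eigenspace_preimage: "subspace (eigenspace (preimage W) \<psi>)"
  by (rule subspace_eigenspace) (simp add: preimage_def linear_E)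

lemma linear_char_proj: "linear (char_proj W \<psi>)"
proof -
  have "linear (\<lambda>v. (1 / card (preimage W)) *\<^sub>R (\<Sum>g\<in>preimage W. \<psi> g *\<^sub>R g v))"
    by (intro linear_compose_scale_right linear_compose_sum ballI linear_E)
      (simp add: preimage_def)
  then show ?thesis by (simp add: char_proj_def[abs_def])
qed

context
  fixes W :: "('i::finite) Ebar set" and \<psi> :: "('i V \<Rightarrow> 'i V) \<Rightarrow> real"
  assumes W: "totally_singular W" and \<psi>: "odd_char W \<psi>"
begin

lemma odd_char_mult:
  "g \<in> preimage W \<Longrightarrow> h \<in> preimage W \<Longrightarrow> \<psi> (g \<circ> h) = \<psi> g * \<psi> h"
  using \<psi> by (simp add: odd_char_def is_character_def)

lemma odd_char_values: "g \<in> preimage W \<Longrightarrow> \<psi> g = 1 \<or> \<psi> g = - 1"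
  using \<psi> by (auto simp: odd_char_def is_character_def)

lemma odd_char_id: "\<psi> id = 1"
  using odd_char_mult[of id id] odd_char_values[of id] id_in_preimage[OF W] by auto

lemma card_preimage_pos: "card (preimage W) > 0"
  using id_in_preimage[OF W] finite_preimage[of W] by (auto simp: card_gt_0_iff)

lemma char_proj_in_eigenspace: "char_proj W \<psi> v \<in> eigenspace (preimage W) \<psi>"
proof -
  let ?S = "preimage W"
  have *: "h (\<Sum>g\<in>?S. \<psi> g *\<^sub>R g v) = \<psi> h *\<^sub>R (\<Sum>g\<in>?S. \<psi> g *\<^sub>R g v)" if h: "h \<in> ?S" for h
  proof -
    note lin = linear_E[OF preimage_E[OF W h]]
    have inv: "h \<circ> (h \<circ> g) = g" for g
      using preimage_square[OF W h] by (simp flip: o_assoc add: o_assoc)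
    have "h (\<Sum>g\<in>?S. \<psi> g *\<^sub>R g v) = (\<Sum>g\<in>?S. \<psi> g *\<^sub>R (h \<circ> g) v)"
      by (simp add: linear_sum[OF lin] linear_cmul[OF lin])
    \<comment> \<open>Left composition with \<open>h\<close> permutes \<open>?S\<close> and is its
      own inverse, since \<open>h \<circ> h = id\<close>.\<close>
    also have "\<dots> = (\<Sum>g\<in>?S. \<psi> (h \<circ> g) *\<^sub>R g v)"
      by (rule sum.reindex_bij_witness[of _ "\<lambda>g. h \<circ> g" "\<lambda>g. h \<circ> g"])
        (simp_all only: inv preimage_comp[OF W h])
    also have "\<dots> = \<psi> h *\<^sub>R (\<Sum>g\<in>?S. \<psi> g *\<^sub>R g v)"
      unfolding scaleR_sum_right by (rule sum.cong) (simp_all add: odd_char_mult h)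
    finally show ?thesis .
  qed
  have "h (char_proj W \<psi> v) = \<psi> h *\<^sub>R char_proj W \<psi> v" if "h \<in> ?S" for h
    using that by (simp add: char_proj_def linear_cmul[OF linear_E[OF preimage_E[OF W that]]] *[OF that])
  then show ?thesis
    by (simp add: eigenspace_def)
qed

text \<open>For \<open>x\<close> in the eigenspace, symmetry of \<open>g\<close> moves it onto
  \<open>x\<close>, producing a second factor \<open>\<psi> g\<close>; as its square is 1, all
  summands contribute the same \<open>x \<bullet> v\<close> to the average.\<close>

lemma is_proj_char_proj: "is_proj (eigenspace (preimage W) \<psi>) (char_proj W \<psi>)"
  unfolding is_proj_def
proof (intro conjI allI ballI char_proj_in_eigenspace)
  fix x v assume x: "x \<in> eigenspace (preimage W) \<psi>"
  have "\<psi> g * (x \<bullet> g v) = x \<bullet> v" if "g \<in> preimage W" for g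
  proof -
    have "\<psi> g * (x \<bullet> g v) = \<psi> g * (g x \<bullet> v)"
      using preimage_symmetric[OF W that] by simp
    also have "g x = \<psi> g *\<^sub>R x" using x that by (simp add: eigenspace_def)
    finally show ?thesis using odd_char_values[OF that] by auto
  qed
  then show "x \<bullet> char_proj W \<psi> v = x \<bullet> v"
    using card_preimage_pos by (simp add: char_proj_def inner_sum_right)
qed

text \<open>Only \<open>id\<close> and \<open>- id\<close> have nonzero trace. They contribute
  equally, as the sign of \<open>\<psi>\<close> at \<open>- id\<close> cancels that of its trace;
  the resulting factor 2 cancels against \<open>card_preimage\<close>.\<close>

lemma tr_char_proj: "tr (char_proj W \<psi>) = 2 ^ CARD('i) / card W"
proof -
  let ?S = "preimage W"
  have "tr (char_proj W \<psi>) = (1 / card ?S) * (\<Sum>g\<in>?S. \<psi> g * tr g)"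
    unfolding tr_def char_proj_def inner_scaleR_left inner_sum_left sum_distrib_left
    by (rule sum.swap)
  also have "(\<Sum>g\<in>?S. \<psi> g * tr g) = (\<Sum>g\<in>{id, - id}. \<psi> g * tr g)"
    using id_in_preimage[OF W] preimage_uminus tr_E preimage_E[OF W]
    by (intro sum.mono_neutral_right finite_preimage) auto
  also have "\<dots> = 2 * 2 ^ CARD('i)"
    using E_neq_uminus[of "id :: 'i V \<Rightarrow> 'i V", OF id_in_E] \<psi>
    by (simp add: odd_char_id odd_char_def tr_uminus tr_id)
  finally show ?thesis by (simp add: card_preimage)
qed

lemma dim_eigenspace: "real (dim (eigenspace (preimage W) \<psi>)) = 2 ^ CARD('i) / card W"
  using tr_proj[OF subspace_eigenspace_preimage is_proj_char_proj] tr_char_proj by simp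

lemma char_proj_fixes:
  assumes "v \<in> eigenspace (preimage W) \<psi>"
  shows "char_proj W \<psi> v = v"
proof -
  let ?p = "char_proj W \<psi> v"
  have "v - ?p \<in> eigenspace (preimage W) \<psi>"
    using assms char_proj_in_eigenspace subspace_eigenspace_preimage by (rule subspace_diff[rotated])
  then have "(v - ?p) \<bullet> ?p = (v - ?p) \<bullet> v"
    using is_proj_char_proj by (simp add: is_proj_def)
  then have "(v - ?p) \<bullet> (v - ?p) = 0" by (simp add: inner_diff_right)
  then show ?thesis by simp
qed

end

text \<open>The pair \<open>(h, g)\<close> matters only if \<open>g\<close> is \<open>h\<close> or
  \<open>- h\<close>, and then the trace of \<open>h \<circ> g\<close> has absolute value
  \<open>2 ^ CARD('i)\<close>. The two characters may disagree on common elements, so passing to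
  absolute values gives an upper bound.\<close>

lemma tr_char_proj_comp_le:
  fixes W W' :: "('i::finite) Ebar set"
  assumes W: "totally_singular W" "odd_char W \<psi>" and W': "totally_singular W'" "odd_char W' \<psi>'"
  shows "tr (char_proj W' \<psi>' \<circ> char_proj W \<psi>) \<le> 2 ^ CARD('i) * card (W \<inter> W') / (card W * card W')"
proof -
  let ?S = "preimage W" and ?S' = "preimage W'"
  have lin: "linear h" if "h \<in> ?S'" for h
    using that by (simp add: preimage_def linear_E)
  have expand: "(char_proj W' \<psi>' \<circ> char_proj W \<psi>) v =
      (1 / (card ?S' * card ?S)) *\<^sub>R (\<Sum>h\<in>?S'. \<Sum>g\<in>?S. (\<psi>' h * \<psi> g) *\<^sub>R (h \<circ> g) v)" for v
    by (simp add: char_proj_def linear_cmul[OF lin] linear_sum[OF lin] scaleR_sum_right ac_simps)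
  have sw: "(\<Sum>b\<in>Basis. \<Sum>h\<in>?S'. \<Sum>g\<in>?S. F b h g) = (\<Sum>h\<in>?S'. \<Sum>g\<in>?S. \<Sum>b\<in>Basis. F b h g)"
    for F :: "'i V \<Rightarrow> _ \<Rightarrow> _ \<Rightarrow> real"
    by (subst sum.swap, rule sum.cong[OF refl], rule sum.swap)
  have "tr (char_proj W' \<psi>' \<circ> char_proj W \<psi>) =
      (1 / (card ?S' * card ?S)) * (\<Sum>h\<in>?S'. \<Sum>g\<in>?S. (\<psi>' h * \<psi> g) * tr (h \<circ> g))"
    unfolding tr_def expand inner_scaleR_left inner_sum_left sum_distrib_left sw ..
  also have "\<dots> \<le> (1 / (card ?S' * card ?S)) * (\<Sum>h\<in>?S'. \<Sum>g\<in>?S. \<bar>tr (h \<circ> g)\<bar>)"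
  proof (intro mult_left_mono sum_mono)
    fix h g assume "h \<in> ?S'" "g \<in> ?S"
    then have "\<psi>' h = 1 \<or> \<psi>' h = -1" "\<psi> g = 1 \<or> \<psi> g = -1"
      using odd_char_values[OF W] odd_char_values[OF W'] by blast+
    then show "\<psi>' h * \<psi> g * tr (h \<circ> g) \<le> \<bar>tr (h \<circ> g)\<bar>" by auto
  qed simp
  also have "(\<Sum>h\<in>?S'. \<Sum>g\<in>?S. \<bar>tr (h \<circ> g)\<bar>) = (\<Sum>h\<in>?S'. if h \<in> ?S then 2 * 2 ^ CARD('i) else 0)"
  proof (rule sum.cong[OF refl])
    fix h assume h: "h \<in> ?S'"
    have hE: "h \<in> E" using h by (simp add: preimage_def)
    have hh: "h \<circ> h = id" by (rule preimage_square[OF W'(1) h])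
    have zero: "tr (h \<circ> g) = 0" if "g \<in> ?S" "g \<noteq> h" "g \<noteq> - h" for g
    proof (rule tr_E)
      show "h \<circ> g \<in> E" using that hE by (simp add: E_comp preimage_def)
      \<comment> \<open>Composing with \<open>h\<close> once more shows that
        \<open>h \<circ> g\<close> equal to \<open>id\<close> or \<open>- id\<close> would mean
        \<open>g = h\<close> or \<open>g = - h\<close>.\<close>
      have *: "h \<circ> (h \<circ> g) = g" using hh by (simp add: o_assoc)
      show "h \<circ> g \<noteq> id" using * that by auto
      show "h \<circ> g \<noteq> - id" using * that o_neg[OF hE, of id] by auto
    qed
    show "(\<Sum>g\<in>?S. \<bar>tr (h \<circ> g)\<bar>) = (if h \<in> ?S then 2 * 2 ^ CARD('i) else 0)"
    proof (cases "h \<in> ?S")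
      case True
      then have "(\<Sum>g\<in>?S. \<bar>tr (h \<circ> g)\<bar>) = (\<Sum>g\<in>{h, - h}. \<bar>tr (h \<circ> g)\<bar>)"
        using zero preimage_uminus by (intro sum.mono_neutral_right finite_preimage) auto
      also have "\<dots> = 2 * 2 ^ CARD('i)"
        using E_neq_uminus[OF hE] by (simp add: hh o_neg[OF hE] tr_uminus tr_id)
      finally show ?thesis using True by simp
    next
      case False
      then have "g \<noteq> h \<and> g \<noteq> - h" if "g \<in> ?S" for g
        using that preimage_uminus[OF that] by auto
      then show ?thesis using zero False by simp
    qed
  qed
  also have "\<dots> = (2 * card (W \<inter> W')) * (2 * 2 ^ CARD('i))"
  proof -
    have "?S' \<inter> ?S = preimage (W \<inter> W')" by (auto simp: preimage_def)
    then show ?thesis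
      by (simp add: sum.If_cases[OF finite_preimage] Collect_mem_eq card_preimage)
  qed
  finally show ?thesis unfolding card_preimage by (simp add: field_simps o_def)
qed

text \<open>Some symmetric \<open>g\<close> has different eigenvalues on the two spaces. The
  assumption compares eigenspaces, not characters, because functions that differ only off the
  preimage define the same eigenspace.\<close>

lemma inner_eigenspaces_eq_0:
  assumes W: "totally_singular W"
    and ne: "eigenspace (preimage W) \<psi> \<noteq> eigenspace (preimage W) \<psi>'"
    and x: "x \<in> eigenspace (preimage W) \<psi>" and y: "y \<in> eigenspace (preimage W) \<psi>'"
  shows "x \<bullet> y = 0"
proof -
  obtain g where g: "g \<in> preimage W" "\<psi> g \<noteq> \<psi>' g"
    using ne unfolding eigenspace_def by fastforce
  have "g x = \<psi> g *\<^sub>R x" "g y = \<psi>' g *\<^sub>R y"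
    using x y g(1) unfolding eigenspace_def by blast+
  then have "\<psi> g * (x \<bullet> y) = g x \<bullet> y" by simp
  also have "\<dots> = \<psi>' g * (x \<bullet> y)"
    using preimage_symmetric[OF W g(1)] \<open>g y = _\<close> by simp
  finally show ?thesis using g(2) by simp
qed

lemma char_proj_comp_eq_0:
  assumes W: "totally_singular W" and \<psi>: "odd_char W \<psi>" "odd_char W \<psi>'"
    and ne: "eigenspace (preimage W) \<psi> \<noteq> eigenspace (preimage W) \<psi>'"
    and x: "x \<in> eigenspace (preimage W) \<psi>"
  shows "char_proj W \<psi>' x = 0"
proof -
  let ?y = "char_proj W \<psi>' x"
  have y: "?y \<in> eigenspace (preimage W) \<psi>'"
    by (rule char_proj_in_eigenspace[OF W \<psi>(2)])
  have "?y \<bullet> ?y = ?y \<bullet> x"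
    using is_proj_char_proj[OF W \<psi>(2)] y by (simp add: is_proj_def)
  also have "\<dots> = 0"
    using inner_eigenspaces_eq_0[OF W ne x y] by (simp add: inner_commute)
  finally show ?thesis by simp
qed

section \<open>Span and number of the invariant subspaces of one preimage\<close>

lemma invariant_subspaces_eq:
  "invariant_subspaces (preimage W) = eigenspace (preimage W) ` {\<psi>. odd_char W \<psi>}"
  by (auto simp: invariant_subspaces_def odd_char_def)

text \<open>An eigenspace depends only on the restriction of the character to the finite preimage,
  and there are finitely many sign functions on it.\<close>

lemma finite_invariant_subspaces: "finite (invariant_subspaces (preimage W))"
proof (rule finite_subset)
  let ?S = "preimage W"
  show "invariant_subspaces ?S \<subseteq> eigenspace ?S ` (\<Pi>\<^sub>E g\<in>?S. {1, - 1})"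
  proof
    fix P assume "P \<in> invariant_subspaces ?S"
    then obtain \<psi> where \<psi>: "is_character ?S \<psi>" "P = eigenspace ?S \<psi>"
      by (auto simp: invariant_subspaces_def)
    have "P = eigenspace ?S (restrict \<psi> ?S)" using \<psi>(2) by (simp add: eigenspace_def)
    moreover have "restrict \<psi> ?S \<in> (\<Pi>\<^sub>E g\<in>?S. {1, - 1})"
      using \<psi>(1) by (auto simp: is_character_def)
    ultimately show "P \<in> eigenspace ?S ` (\<Pi>\<^sub>E g\<in>?S. {1, - 1})" by blast
  qed
  show "finite (eigenspace ?S ` (\<Pi>\<^sub>E g\<in>?S. {1, - 1}))"
    by (intro finite_imageI finite_PiE finite_preimage) simp
qed

text \<open>
  Splitting \<open>v = (v + h v) / 2 + (v - h v) / 2\<close> for one involution \<open>h\<close> at a time preserves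
  eigenvectors of the involutions treated before, as all of them commute.
\<close>

lemma span_common_eigenvectors:
  assumes W: "totally_singular W" and "finite T" "T \<subseteq> preimage W"
  shows "span {v. \<forall>g\<in>T. g v = v \<or> g v = - v} = UNIV"
  using assms(2,3)
proof (induction T rule: finite_induct)
  case (insert h T)
  let ?D = "{v. \<forall>g\<in>insert h T. g v = v \<or> g v = - v}"
  have h: "h \<in> preimage W" and T: "T \<subseteq> preimage W" using insert.prems by auto
  have lin: "linear g" if "g \<in> preimage W" for g
    using that by (simp add: preimage_def linear_E)
  have "v \<in> span ?D" if v: "\<forall>g\<in>T. g v = v \<or> g v = - v" for v
  proof -
    have hh: "h (v + h v) = v + h v" "h (v - h v) = - (v - h v)"
      using preimage_apply_twice[OF W h, of v] by (simp_all add: linear_add linear_diff lin h)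
    have "(g (v + h v) = v + h v \<and> g (v - h v) = v - h v) \<or>
        (g (v + h v) = - (v + h v) \<and> g (v - h v) = - (v - h v))" if "g \<in> T" for g
    proof -
      have "g \<in> preimage W" using that T by auto
      then have "g (v + h v) = g v + h (g v)" "g (v - h v) = g v - h (g v)"
        by (simp_all add: linear_add linear_diff lin preimage_commute[OF W _ h])
      then show ?thesis
        using v that by (auto simp: linear_neg lin h)
    qed
    then have "v + h v \<in> ?D" "v - h v \<in> ?D" using hh by auto
    then have "(1/2) *\<^sub>R (v + h v) + (1/2) *\<^sub>R (v - h v) \<in> span ?D"
      by (intro span_add span_scale span_base)
    moreover have "(1/2) *\<^sub>R (v + h v) + (1/2) *\<^sub>R (v - h v) = v"
      by (simp add: algebra_simps flip: scaleR_add_left)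
    ultimately show ?thesis by simp
  qed
  then have "span {v. \<forall>g\<in>T. g v = v \<or> g v = - v} \<subseteq> span ?D"
    by (intro span_minimal subspace_span) auto
  with insert.IH[OF T] show ?case by auto
qed simp

text \<open>The common eigenvectors of the whole preimage span the space, and each nonzero one lies
  in an invariant subspace: the signs by which the group acts on it form an odd character.\<close>

lemma span_invariant_subspaces:
  fixes W :: "('i::finite) Ebar set"
  assumes W: "totally_singular W"
  shows "span (\<Union>(invariant_subspaces (preimage W))) = UNIV"
proof -
  let ?S = "preimage W"
  have "v \<in> span (\<Union>(invariant_subspaces ?S))" if v: "\<forall>g\<in>?S. g v = v \<or> g v = - v" for v
  proof (cases "v = 0")
    case False
    define \<psi> :: "('i V \<Rightarrow> 'i V) \<Rightarrow> real" where "\<psi> g = (if g v = v then 1 else - 1)" for g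
    have ev: "g v = \<psi> g *\<^sub>R v" if "g \<in> ?S" for g
      using v that by (auto simp: \<psi>_def)
    have "\<psi> (g \<circ> h) = \<psi> g * \<psi> h" if "g \<in> ?S" "h \<in> ?S" for g h
    proof -
      have "\<psi> (g \<circ> h) *\<^sub>R v = g (h v)"
        using ev[OF preimage_comp[OF W that]] by simp
      also have "\<dots> = (\<psi> g * \<psi> h) *\<^sub>R v"
        using ev[OF that(1)] ev[OF that(2)] linear_cmul[OF linear_E[OF preimage_E[OF W that(1)]]]
        by (simp add: mult.commute)
      finally show ?thesis using False by simp
    qed
    moreover have "- v \<noteq> v"
    proof
      assume "- v = v"
      then have "v + v = 0" by (metis add.right_inverse)
      then have "(2::real) *\<^sub>R v = 0" by (simp only: scaleR_2)
      then show False using False by simp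
    qed
    then have "\<psi> (- id) = - 1" by (simp add: \<psi>_def)
    ultimately have "odd_char W \<psi>"
      by (auto simp: odd_char_def is_character_def \<psi>_def)
    moreover have "v \<in> eigenspace ?S \<psi>" using ev by (simp add: eigenspace_def)
    ultimately show ?thesis
      unfolding invariant_subspaces_eq by (intro span_base) blast
  qed (simp add: span_zero)
  then have "span {v. \<forall>g\<in>?S. g v = v \<or> g v = - v} \<subseteq> span (\<Union>(invariant_subspaces ?S))"
    by (intro span_minimal subspace_span) auto
  with span_common_eigenvectors[OF W finite_preimage, of W] show ?thesis by auto
qed

text \<open>The projections onto the invariant subspaces add up to the identity; compare traces.\<close>

lemma card_invariant_subspaces:
  fixes W :: "('i::finite) Ebar set"
  assumes W: "totally_singular W"
  shows "card (invariant_subspaces (preimage W)) = card W"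
proof -
  let ?S = "preimage W" and ?I = "invariant_subspaces (preimage W)"
  have "\<forall>P\<in>?I. \<exists>\<psi>. odd_char W \<psi> \<and> P = eigenspace ?S \<psi>"
    unfolding invariant_subspaces_eq by blast
  \<comment> \<open>Many functions define the same eigenspace; \<open>c\<close> fixes one character
    for each subspace, so that every subspace enters the sum \<open>F\<close> exactly once.\<close>
  then obtain c where c: "\<And>P. P \<in> ?I \<Longrightarrow> odd_char W (c P)" "\<And>P. P \<in> ?I \<Longrightarrow> P = eigenspace ?S (c P)"
    by metis
  define F where "F v = (\<Sum>P\<in>?I. char_proj W (c P) v)" for v
  have lin: "linear F"
    unfolding F_def[abs_def] by (intro linear_compose_sum ballI linear_char_proj)
  have F: "F v = id v" if "v \<in> \<Union>?I" for v
  proof -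
    obtain P where P: "P \<in> ?I" "v \<in> P" using \<open>v \<in> \<Union>?I\<close> by blast
    \<comment> \<open>A vector of \<open>P\<close> is fixed by the projection belonging to
      \<open>P\<close> and killed by all the others, so \<open>F\<close> is the identity on a
      spanning set.\<close>
    have "char_proj W (c P') v = (if P' = P then v else 0)" if "P' \<in> ?I" for P'
      using char_proj_fixes[OF W c(1)[OF P(1)], of v] P c(2)[OF P(1)] c(2)[OF that]
        char_proj_comp_eq_0[OF W c(1)[OF P(1)] c(1)[OF that], of v]
      by auto
    then show ?thesis
      unfolding F_def using P(1) finite_invariant_subspaces[of W] by simp
  qed
  have "F = id"
  proof
    show "F v = id v" for v
      by (rule linear_eq_on_span[where B = "\<Union>?I", OF lin linear_id F])
        (simp_all add: span_invariant_subspaces[OF W])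
  qed
  have "2 ^ CARD('i) = tr F" unfolding \<open>F = id\<close> by (rule tr_id[symmetric])
  also have "\<dots> = (\<Sum>P\<in>?I. tr (char_proj W (c P)))"
    unfolding tr_def F_def inner_sum_left by (rule sum.swap)
  also have "\<dots> = card ?I * (2 ^ CARD('i) / card W)"
    using tr_char_proj[OF W c(1)] by simp
  finally have "(2::real) ^ CARD('i) = card ?I * (2 ^ CARD('i) / card W)" .
  moreover have "card W > 0"
    using id_in_preimage[OF W] finite_Ebar[of W] by (auto simp: card_gt_0_iff preimage_def)
  ultimately show ?thesis by (simp add: field_simps)
qed

section \<open>The packing and its minimal distance\<close>

theorem theorem2:
  fixes \<S> :: "('i::finite) Ebar set set"
    and i k l M :: nat
  assumes "i = CARD('i)"
    and "k \<le> i"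
    and "finite \<S>" and "card \<S> = M"
    and "\<And>S. S \<in> \<S> \<Longrightarrow> totally_singular S \<and> Ebar.dim S = i - k"
    and "\<And>S T. S \<in> \<S> \<Longrightarrow> T \<in> \<S> \<Longrightarrow> S \<noteq> T \<Longrightarrow> Ebar.dim (S \<inter> T) \<le> l"
  defines "\<P> \<equiv> (\<Union>S\<in>\<S>. invariant_subspaces (preimage S))"
  shows "is_packing (2 ^ (i - k) * M) (2 ^ k) \<P>
    \<and> (\<forall>P\<in>\<P>. \<forall>P'\<in>\<P>. P \<noteq> P' \<longrightarrow>
         (plane_dist P P')\<^sup>2 \<ge> 2 ^ k - 2 powi (2 * int k + int l - int i))
    \<and> (card \<P> \<ge> 2 \<longrightarrow>
         (min_dist \<P>)\<^sup>2 \<ge> 2 ^ k - 2 powi (2 * int k + int l - int i))"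
proof -
  let ?d = "2 ^ k - 2 powi (2 * int k + int l - int i) :: real"
  have ts: "totally_singular S" if "S \<in> \<S>" for S
    using assms(5)[OF that] by simp
  have card_S: "card S = 2 ^ (i - k)" if "S \<in> \<S>" for S
    using assms(5)[OF that] card_Ebar_subspace[of S] by (simp add: totally_singular_def)
  have quot: "(2::real) ^ i / 2 ^ (i - k) = 2 ^ k"
    using \<open>k \<le> i\<close> by (simp add: power_diff)
  have \<P>E: "\<exists>S \<psi>. S \<in> \<S> \<and> odd_char S \<psi> \<and> P = eigenspace (preimage S) \<psi>" if "P \<in> \<P>" for P
    using that unfolding \<P>_def invariant_subspaces_eq by blast
  have dim_plane: "dim (eigenspace (preimage S) \<psi>) = 2 ^ k" if "S \<in> \<S>" "odd_char S \<psi>" for S \<psi>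
  proof -
    have "real (dim (eigenspace (preimage S) \<psi>)) = real (2 ^ k)"
      using dim_eigenspace[OF ts that(2)] that quot card_S assms(1) by simp
    then show ?thesis by (simp only: of_nat_eq_iff)
  qed
  \<comment> \<open>The bound is the plane dimension times the proportion of \<open>S\<close> lying
    in \<open>T\<close>. It serves both to separate the planes of different members and to estimate
    distances.\<close>
  have tr_le: "tr (char_proj T \<psi>' \<circ> char_proj S \<psi>) \<le> 2 ^ k * (card (S \<inter> T) / 2 ^ (i - k))"
    if "S \<in> \<S>" "T \<in> \<S>" "odd_char S \<psi>" "odd_char T \<psi>'" for S T \<psi> \<psi>'
  proof -
    have "tr (char_proj T \<psi>' \<circ> char_proj S \<psi>) \<le> 2 ^ i * card (S \<inter> T) / (2 ^ (i - k) * 2 ^ (i - k))"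
      using tr_char_proj_comp_le[OF ts that(3) ts that(4)] that card_S assms(1) by simp
    also have "\<dots> = (2 ^ i / 2 ^ (i - k)) * (card (S \<inter> T) / 2 ^ (i - k))" by simp
    finally show ?thesis unfolding quot .
  qed
  \<comment> \<open>For \<open>l \<ge> i - k\<close> the distance bound is not positive, so
    distinctness of planes is shown separately. A shared plane would give the product of the
    projections the full trace \<open>2 ^ k\<close>; then \<open>S \<inter> T\<close> is as large as
    \<open>S\<close>, and equal cardinalities force \<open>S = T\<close>.\<close>
  have disj: "invariant_subspaces (preimage S) \<inter> invariant_subspaces (preimage T) = {}"
    if ST: "S \<in> \<S>" "T \<in> \<S>" "S \<noteq> T" for S T
  proof (rule ccontr)
    assume "\<not> ?thesis"
    then obtain \<psi> \<psi>' where \<psi>: "odd_char S \<psi>" "odd_char T \<psi>'"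
      and eq: "eigenspace (preimage S) \<psi> = eigenspace (preimage T) \<psi>'"
      unfolding invariant_subspaces_eq by blast
    have "char_proj T \<psi>' \<circ> char_proj S \<psi> = char_proj S \<psi>"
      using char_proj_fixes[OF ts[OF ST(2)] \<psi>(2)] char_proj_in_eigenspace[OF ts[OF ST(1)] \<psi>(1)] eq
      by (auto simp: fun_eq_iff)
    then have "2 ^ k \<le> 2 ^ k * (card (S \<inter> T) / 2 ^ (i - k))"
      using tr_le[OF ST(1,2) \<psi>] tr_char_proj[OF ts \<psi>(1)] ST card_S assms(1) quot by simp
    then have "real (card S) \<le> card (S \<inter> T)"
      using card_S[OF ST(1)] by (simp add: field_simps)
    then have "S \<inter> T = S"
      by (intro card_seteq finite_Ebar) auto
    then have "S \<subseteq> T" by blast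
    then have "S = T"
      using card_S ST by (intro card_subset_eq finite_Ebar) auto
    with ST show False by simp
  qed
  have packing: "is_packing (2 ^ (i - k) * M) (2 ^ k) \<P>"
    unfolding is_packing_def
  proof (intro conjI)
    show "\<P> \<subseteq> Grassmannian (2 ^ k)"
      using \<P>E dim_plane subspace_eigenspace_preimage unfolding Grassmannian_def by blast
    show "finite \<P>"
      unfolding \<P>_def using assms(3) finite_invariant_subspaces by blast
    have "card \<P> = (\<Sum>S\<in>\<S>. card (invariant_subspaces (preimage S)))"
      unfolding \<P>_def using assms(3) finite_invariant_subspaces disj
      by (intro card_UN_disjoint) auto
    also have "\<dots> = (\<Sum>S\<in>\<S>. 2 ^ (i - k))"
      by (rule sum.cong) (simp_all add: card_invariant_subspaces ts card_S)
    finally show "card \<P> = 2 ^ (i - k) * M" using assms(4) by simp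
  qed
  have dist: "(plane_dist P P')\<^sup>2 \<ge> ?d" if PP': "P \<in> \<P>" "P' \<in> \<P>" "P \<noteq> P'" for P P'
  proof -
    obtain S \<psi> T \<psi>' where S: "S \<in> \<S>" "odd_char S \<psi>" "P = eigenspace (preimage S) \<psi>"
      and T: "T \<in> \<S>" "odd_char T \<psi>'" "P' = eigenspace (preimage T) \<psi>'"
      using \<P>E PP' by meson
    have "(plane_dist P P')\<^sup>2 = 2 ^ k - tr (char_proj T \<psi>' \<circ> char_proj S \<psi>)"
      using plane_dist_sq[OF subspace_eigenspace_preimage subspace_eigenspace_preimage _
          is_proj_char_proj[OF ts S(2)] is_proj_char_proj[OF ts T(2)] linear_char_proj]
        dim_plane S T by simp
    moreover have "tr (char_proj T \<psi>' \<circ> char_proj S \<psi>) \<le> 2 powi (2 * int k + int l - int i)"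
    \<comment> \<open>Planes from the same preimage are orthogonal, so the trace is 0. For different
      members the dimension of the intersection enters. The exponent can be negative, hence
      \<open>powi\<close>.\<close>
    proof (cases "S = T")
      case True
      then have "char_proj T \<psi>' \<circ> char_proj S \<psi> = (\<lambda>v. 0)"
        using char_proj_comp_eq_0[OF ts S(2), of \<psi>'] char_proj_in_eigenspace[OF ts S(2)] S T PP'(3)
        by (auto simp: fun_eq_iff)
      then show ?thesis by (simp add: tr_def)
    next
      case False
      have "Ebar.subspace (S \<inter> T)"
        using ts S(1) T(1) unfolding totally_singular_def by (intro Ebar.subspace_inter) auto
      then have "card (S \<inter> T) = 2 ^ Ebar.dim (S \<inter> T)" by (rule card_Ebar_subspace)
      then have "real (card (S \<inter> T)) \<le> 2 ^ l"
        using assms(6)[OF S(1) T(1) False] by simp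
      then have "2 ^ k * (card (S \<inter> T) / 2 ^ (i - k)) \<le> 2 ^ k * ((2::real) ^ l / 2 ^ (i - k))"
        by (intro mult_left_mono divide_right_mono) auto
      also have "\<dots> = 2 powi (int k + int l - int (i - k))"
        by (simp add: power_int_diff power_int_add power_int_of_nat)
      also have "int k + int l - int (i - k) = 2 * int k + int l - int i"
        using \<open>k \<le> i\<close> by simp
      finally show ?thesis using tr_le[OF S(1) T(1) S(2) T(2)] by simp
    qed
    ultimately show ?thesis by simp
  qed
  have "(min_dist \<P>)\<^sup>2 \<ge> ?d" if "card \<P> \<ge> 2"
  proof -
    let ?D = "{plane_dist P P' | P P'. P \<in> \<P> \<and> P' \<in> \<P> \<and> P \<noteq> P'}"
    have fin: "finite \<P>" using packing by (simp add: is_packing_def)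
    have "?D \<subseteq> (\<lambda>(P, P'). plane_dist P P') ` (\<P> \<times> \<P>)" by auto
    then have "finite ?D" by (rule finite_subset) (use fin in simp)
    moreover have "?D \<noteq> {}"
    proof -
      have "\<not> card \<P> \<le> Suc 0" using that by simp
      then obtain P P' where "P \<in> \<P>" "P' \<in> \<P>" "P \<noteq> P'"
        unfolding card_le_Suc0_iff_eq[OF fin] by blast
      then show ?thesis by blast
    qed
    \<comment> \<open>The set of distances is finite, and nonempty because there are two planes, so
      its \<open>Min\<close> is attained by a pair of distinct planes.\<close>
    ultimately have "min_dist \<P> \<in> ?D"
      unfolding min_dist_def by (rule Min_in)
    then obtain P P' where P: "P \<in> \<P>" "P' \<in> \<P>" "P \<noteq> P'" and eq: "min_dist \<P> = plane_dist P P'"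
      by blast
    show ?thesis unfolding eq by (rule dist[OF P])
  qed
  then show ?thesis by (intro conjI packing ballI impI dist)
qed

end
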